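(* Let $(M,g)$ be a strongly causal spacetime, let $\Omega\colon M\to(0,+\infty)$ be smooth, let $\gamma\colon[a,b]\to M$ be a causal curve in $M$, and let $\widetilde g:=\Omega^2g$. Let $\tau=\tau_g$. Then $$L_\Omega^\tau(\gamma)=L_{\widetilde g}(\gamma)=\int_a^b\Omega(\gamma(t))\sqrt{-g(\dot\gamma(t),\dot\gamma(t))}\,dt.$$ In particular, the time separation functions agree, i.e. $\tau_\Omega=\tau_{\Omega^2g}$.
   Context: A spacetime $(M,g)$ is a connected, smooth, time-oriented manifold $M$ with a (smooth) Lorentzian metric $g$ of signature $(-,+,\dots,+)$. Causal curves are locally Lipschitz curves whose derivative is future-directed causal almost everywhere. One writes $x\ll y$ (resp. $x\leq y$) if there is a future-directed timelike (resp. causal) curve from $x$ to $y$ (with $x\leq x$ always). For a causal curve $\gamma\colon[a,b]\to M$, $L_g(\gamma)=\int_a^b\sqrt{-g(\dot\gamma,\dot\gamma)}\,dt$, and $$\tau_g(x,y)=\sup\big(\{0\}\cup\{L_g(\gamma):\gamma\text{ a causal curve from }x\text{ to }y\}\big);$$ $L_{\widetilde g}$ and $\tau_{\widetilde g}$ are defined in the same way from $\widetilde g$. With $d^h$ the distance of any Riemannian metric $h$ on $M$, $(M,d^h,\ll,\leq,\tau_g)$ is the Lorentzian pre-length space induced by $(M,g)$. Strongly causal means: for every $x\in M$ and every neighbourhood $U$ of $x$ there is a neighbourhood $V\subseteq U$ of $x$ such that every causal curve $\gamma\colon[a,b]\to M$ with $\gamma(a),\gamma(b)\in V$ is contained in $U$.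 For a causal curve $\gamma\colon[a,b]\to M$ and $\tau=\tau_g$ put $$L_\Omega^\tau(\gamma):=\inf\Big\{\sum_{i=0}^{m-1}\max_{t\in[t_i,t_{i+1}]}\Omega(\gamma(t))\,\tau(\gamma(t_i),\gamma(t_{i+1}))\ :\ a=t_0<\dots<t_m=b\Big\},$$ $$\tau_\Omega(x,y):=\sup\big(\{0\}\cup\{L_\Omega^\tau(\gamma):\gamma\text{ a causal curve from }x\text{ to }y\}\big).$$ *)

theory Defs
  imports "HOL-Analysis.Analysis"
begin

section \<open>Smooth maps between open subsets of Euclidean spaces\<close>

text \<open>\<open>Ck_on k S f\<close> is meant for open \<open>S\<close> and finite-dimensional domain: all directional
  derivatives of order at most \<open>k\<close> exist and are continuous on \<open>S\<close>.\<close>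

fun Ck_on :: "nat \<Rightarrow> 'a::euclidean_space set \<Rightarrow> ('a \<Rightarrow> 'b::real_normed_vector) \<Rightarrow> bool" where
  "Ck_on 0 S f \<longleftrightarrow> continuous_on S f"
| "Ck_on (Suc k) S f \<longleftrightarrow>
     (\<forall>x\<in>S. f differentiable (at x)) \<and> (\<forall>v. Ck_on k S (\<lambda>x. frechet_derivative f (at x) v))"

definition smooth_on :: "'a::euclidean_space set \<Rightarrow> ('a \<Rightarrow> 'b::real_normed_vector) \<Rightarrow> bool" where
  "smooth_on S f \<longleftrightarrow> (\<forall>k. Ck_on k S f)"

section \<open>Smooth manifolds\<close>

text \<open>The underlying topological space of the manifold is the whole type \<open>'a\<close> (of class
  \<^class>\<open>t2_space\<close> and \<^class>\<open>second_countable_topology\<close>); the model space is \<open>'e\<close>, so the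
  dimension of the manifold is \<open>DIM('e)\<close>. A chart is a pair of its domain and the coordinate map;
  values of the coordinate map outside the domain are irrelevant. The smooth structure is given
  by an atlas, which need not be maximal.\<close>

type_synonym ('a, 'e) chart = "'a set \<times> ('a \<Rightarrow> 'e)"

abbreviation cdom :: "('a, 'e) chart \<Rightarrow> 'a set" where "cdom \<equiv> fst"

abbreviation coord :: "('a, 'e) chart \<Rightarrow> 'a \<Rightarrow> 'e" where "coord \<equiv> snd"

definition cinv :: "('a, 'e) chart \<Rightarrow> 'e \<Rightarrow> 'a" where
  "cinv c = inv_into (cdom c) (coord c)"

definition is_chart :: "('a::topological_space, 'e::euclidean_space) chart \<Rightarrow> bool" where
  "is_chart c \<longleftrightarrow> open (cdom c) \<and> open (coord c ` cdom c) \<and>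
     homeomorphism (cdom c) (coord c ` cdom c) (coord c) (cinv c)"

definition smooth_atlas :: "('a::topological_space, 'e::euclidean_space) chart set \<Rightarrow> bool" where
  "smooth_atlas A \<longleftrightarrow> (\<forall>c\<in>A. is_chart c) \<and> (\<Union>c\<in>A. cdom c) = UNIV \<and>
     (\<forall>c\<in>A. \<forall>c'\<in>A. smooth_on (coord c ` (cdom c \<inter> cdom c')) (coord c' \<circ> cinv c))"

definition smooth_function ::
  "('a::topological_space, 'e::euclidean_space) chart set \<Rightarrow> ('a \<Rightarrow> real) \<Rightarrow> bool" where
  "smooth_function A f \<longleftrightarrow> (\<forall>c\<in>A. smooth_on (coord c ` cdom c) (f \<circ> cinv c))"

section \<open>Tangent vectors and Lorentzian metrics\<close>

text \<open>A tangent vector at \<open>p\<close> is the family of its coordinate representations in all charts of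
  the atlas around \<open>p\<close>, any two of which are related by the differential of the transition map
  (and \<open>0\<close> for the other arguments, where there is nothing to represent).
  \<open>chart_vector A c p v\<close> is the tangent vector at \<open>p\<close> whose representation in \<open>c\<close> is \<open>v\<close>.\<close>

type_synonym ('a, 'e) tvec = "('a, 'e) chart \<Rightarrow> 'e"

definition chart_vector :: "('a, 'e::euclidean_space) chart set \<Rightarrow> ('a, 'e) chart \<Rightarrow> 'a \<Rightarrow> 'e
    \<Rightarrow> ('a, 'e) tvec" where
  "chart_vector A c p v = (\<lambda>c'. if c' \<in> A \<and> p \<in> cdom c'
     then frechet_derivative (coord c' \<circ> cinv c) (at (coord c p)) v else 0)"

definition tangent_space :: "('a, 'e::euclidean_space) chart set \<Rightarrow> 'a \<Rightarrow> ('a, 'e) tvec set" where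
  "tangent_space A p = {chart_vector A c p v |c v. c \<in> A \<and> p \<in> cdom c}"

text \<open>A metric is a map \<open>g\<close> with \<open>g p\<close> a form on the tangent space at \<open>p\<close>;
  its values on functions that are not tangent vectors at \<open>p\<close> are irrelevant.\<close>

type_synonym ('a, 'e) metric = "'a \<Rightarrow> ('a, 'e) tvec \<Rightarrow> ('a, 'e) tvec \<Rightarrow> real"

definition metric_in_chart :: "('a, 'e::euclidean_space) chart set \<Rightarrow> ('a, 'e) metric
    \<Rightarrow> ('a, 'e) chart \<Rightarrow> 'a \<Rightarrow> 'e \<Rightarrow> 'e \<Rightarrow> real" where
  "metric_in_chart A g c p v w = g p (chart_vector A c p v) (chart_vector A c p w)"

text \<open>Signature \<open>(-,+,\<dots>,+)\<close>: the vectors \<open>f i\<close> are automatically linearly independent,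
  hence a basis in which the form has matrix \<open>diag(-1,1,\<dots>,1)\<close>.\<close>

definition lorentzian_form :: "('e::euclidean_space \<Rightarrow> 'e \<Rightarrow> real) \<Rightarrow> bool" where
  "lorentzian_form B \<longleftrightarrow> bilinear B \<and> (\<forall>v w. B v w = B w v) \<and>
     (\<exists>f :: 'e \<Rightarrow> 'e. \<exists>e\<^sub>0\<in>Basis. \<forall>i\<in>Basis. \<forall>j\<in>Basis.
        B (f i) (f j) = (if i \<noteq> j then 0 else if i = e\<^sub>0 then -1 else 1))"

definition lorentzian_metric ::
  "('a::topological_space, 'e::euclidean_space) chart set \<Rightarrow> ('a, 'e) metric \<Rightarrow> bool" where
  "lorentzian_metric A g \<longleftrightarrow>
     (\<forall>c\<in>A. (\<forall>p\<in>cdom c. lorentzian_form (metric_in_chart A g c p)) \<and>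
            (\<forall>v w. smooth_on (coord c ` cdom c) (\<lambda>x. metric_in_chart A g c (cinv c x) v w)))"

text \<open>A time orientation is given by a continuous timelike vector field \<open>T\<close>.\<close>

definition time_orientation :: "('a::topological_space, 'e::euclidean_space) chart set
    \<Rightarrow> ('a, 'e) metric \<Rightarrow> ('a \<Rightarrow> ('a, 'e) tvec) \<Rightarrow> bool" where
  "time_orientation A g T \<longleftrightarrow>
     (\<forall>p. T p \<in> tangent_space A p \<and> g p (T p) (T p) < 0) \<and>
     (\<forall>c\<in>A. continuous_on (cdom c) (\<lambda>p. T p c))"

definition spacetime :: "('a::{t2_space, second_countable_topology}, 'e::euclidean_space) chart set
    \<Rightarrow> ('a, 'e) metric \<Rightarrow> ('a \<Rightarrow> ('a, 'e) tvec) \<Rightarrow> bool" where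
  "spacetime A g T \<longleftrightarrow> connected (UNIV :: 'a set) \<and> smooth_atlas A \<and>
     lorentzian_metric A g \<and> time_orientation A g T"

text \<open>\<open>g p T T < 0\<close> and \<open>g p T X < 0\<close> force \<open>X \<noteq> 0\<close>, so the zero vector is excluded.\<close>

definition future_causal :: "('a, 'e) metric \<Rightarrow> ('a \<Rightarrow> ('a, 'e) tvec) \<Rightarrow> 'a \<Rightarrow> ('a, 'e) tvec
    \<Rightarrow> bool" where
  "future_causal g T p X \<longleftrightarrow> g p X X \<le> 0 \<and> g p (T p) X < 0"

definition conformal_metric :: "('a \<Rightarrow> real) \<Rightarrow> ('a, 'e) metric \<Rightarrow> ('a, 'e) metric" where
  "conformal_metric \<Omega> g = (\<lambda>p X Y. (\<Omega> p)\<^sup>2 * g p X Y)"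

section \<open>Causal curves, length and time separation\<close>

text \<open>Curves are functions on \<^typ>\<open>real\<close> of which only the restriction to \<open>{a..b}\<close> matters.\<close>

definition curve_differentiable :: "('a, 'e::euclidean_space) chart set \<Rightarrow> real \<Rightarrow> real
    \<Rightarrow> (real \<Rightarrow> 'a) \<Rightarrow> real \<Rightarrow> bool" where
  "curve_differentiable A a b \<gamma> t \<longleftrightarrow>
     (\<forall>c\<in>A. \<gamma> t \<in> cdom c \<longrightarrow> (coord c \<circ> \<gamma>) differentiable (at t within {a..b}))"

definition velocity :: "('a, 'e::euclidean_space) chart set \<Rightarrow> real \<Rightarrow> real
    \<Rightarrow> (real \<Rightarrow> 'a) \<Rightarrow> real \<Rightarrow> ('a, 'e) tvec" where
  "velocity A a b \<gamma> t = (\<lambda>c. if c \<in> A \<and> \<gamma> t \<in> cdom c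
     then vector_derivative (coord c \<circ> \<gamma>) (at t within {a..b}) else 0)"

definition locally_lipschitz_curve :: "('a, 'e::euclidean_space) chart set \<Rightarrow> real \<Rightarrow> real
    \<Rightarrow> (real \<Rightarrow> 'a) \<Rightarrow> bool" where
  "locally_lipschitz_curve A a b \<gamma> \<longleftrightarrow>
     (\<forall>t\<in>{a..b}. \<exists>c\<in>A. \<exists>\<delta>>0. \<exists>K.
        \<gamma> ` ({a..b} \<inter> ball t \<delta>) \<subseteq> cdom c \<and>
        K-lipschitz_on ({a..b} \<inter> ball t \<delta>) (coord c \<circ> \<gamma>))"

definition causal_curve :: "('a, 'e::euclidean_space) chart set \<Rightarrow> ('a, 'e) metric
    \<Rightarrow> ('a \<Rightarrow> ('a, 'e) tvec) \<Rightarrow> real \<Rightarrow> real \<Rightarrow> (real \<Rightarrow> 'a) \<Rightarrow> bool" where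
  "causal_curve A g T a b \<gamma> \<longleftrightarrow> a < b \<and> locally_lipschitz_curve A a b \<gamma> \<and>
     (AE t in lebesgue_on {a..b}.
        curve_differentiable A a b \<gamma> t \<and> future_causal g T (\<gamma> t) (velocity A a b \<gamma> t))"

definition strongly_causal :: "('a::topological_space, 'e::euclidean_space) chart set
    \<Rightarrow> ('a, 'e) metric \<Rightarrow> ('a \<Rightarrow> ('a, 'e) tvec) \<Rightarrow> bool" where
  "strongly_causal A g T \<longleftrightarrow>
     (\<forall>x U. open U \<and> x \<in> U \<longrightarrow> (\<exists>V\<subseteq>U. open V \<and> x \<in> V \<and>
        (\<forall>a b \<gamma>. causal_curve A g T a b \<gamma> \<and> \<gamma> a \<in> V \<and> \<gamma> b \<in> V \<longrightarrow> \<gamma> ` {a..b} \<subseteq> U)))"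

definition metric_length :: "('a, 'e::euclidean_space) chart set \<Rightarrow> ('a, 'e) metric
    \<Rightarrow> real \<Rightarrow> real \<Rightarrow> (real \<Rightarrow> 'a) \<Rightarrow> ennreal" where
  "metric_length A g a b \<gamma> =
     (\<integral>\<^sup>+t. ennreal (sqrt (- g (\<gamma> t) (velocity A a b \<gamma> t) (velocity A a b \<gamma> t)))
        \<partial>lebesgue_on {a..b})"

definition time_separation :: "('a, 'e::euclidean_space) chart set \<Rightarrow> ('a, 'e) metric
    \<Rightarrow> ('a \<Rightarrow> ('a, 'e) tvec) \<Rightarrow> 'a \<Rightarrow> 'a \<Rightarrow> ennreal" where
  "time_separation A g T x y =
     Sup ({0} \<union> {metric_length A g a b \<gamma> |a b \<gamma>. causal_curve A g T a b \<gamma> \<and> \<gamma> a = x \<and> \<gamma> b = y})"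

section \<open>Conformal length and conformal time separation\<close>

text \<open>The real supremum below is a maximum, since \<open>\<Omega> \<circ> \<gamma>\<close> is continuous on the compact interval
  \<open>{t i..t (Suc i)}\<close> in every intended use.\<close>

definition conformal_length :: "('a \<Rightarrow> 'a \<Rightarrow> ennreal) \<Rightarrow> ('a \<Rightarrow> real) \<Rightarrow> real \<Rightarrow> real
    \<Rightarrow> (real \<Rightarrow> 'a) \<Rightarrow> ennreal" where
  "conformal_length \<tau> \<Omega> a b \<gamma> =
     Inf {\<Sum>i<m. ennreal (SUP s\<in>{t i..t (Suc i)}. \<Omega> (\<gamma> s)) * \<tau> (\<gamma> (t i)) (\<gamma> (t (Suc i))) |t m.
       t 0 = a \<and> t m = b \<and> (\<forall>i<m. t i < t (Suc i))}"

definition conformal_time_separation :: "('a, 'e::euclidean_space) chart set \<Rightarrow> ('a, 'e) metric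
    \<Rightarrow> ('a \<Rightarrow> ('a, 'e) tvec) \<Rightarrow> ('a \<Rightarrow> real) \<Rightarrow> 'a \<Rightarrow> 'a \<Rightarrow> ennreal" where
  "conformal_time_separation A g T \<Omega> x y =
     Sup ({0} \<union> {conformal_length (time_separation A g T) \<Omega> a b \<gamma> |a b \<gamma>.
       causal_curve A g T a b \<gamma> \<and> \<gamma> a = x \<and> \<gamma> b = y})"

end

theory Submission
  imports Defs
begin

text \<open>
Write \<open>L\<close> for the integral of \<open>\<Omega> * speed\<close> along the causal curve \<open>\<gamma>\<close>. As
\<open>sqrt (- \<Omega>\<^sup>2 g) = \<Omega> * sqrt (- g)\<close>, this is the length for \<open>\<Omega>\<^sup>2 g\<close>; moreover both metrics have the same causal
curves. So the equality of the time separation functions follows once the conformal length of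
every causal curve is shown to be \<open>L\<close>.

Every partition sum is at least \<open>L\<close>, because each piece of \<open>\<gamma>\<close> is a competitor in the supremum that
defines \<open>\<tau>\<close> (\<open>weighted_length_le_conformal_length\<close>).

The reverse inequality needs an upper bound of \<open>\<tau>\<close> between neighbouring points of \<open>\<gamma>\<close>, so over all
causal curves between them. In a chart around \<open>p\<close>, coordinates diagonalise the metric at \<open>p\<close> to
\<open>\<bar>P v\<bar>\<^sup>2 - (\<alpha> v)\<^sup>2\<close>. Given \<open>\<epsilon> > 0\<close>, at all points near \<open>p\<close> the causal vectors lie in the cone of
the flat form \<open>\<bar>P v\<bar>\<^sup>2 - (1 + \<epsilon>) (\<alpha> v)\<^sup>2\<close>, and their proper time is at most the one which that form measures
(\<open>cone_neighbourhood\<close>). Strong causality keeps the competing curves in this neighbourhood, and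
for a flat metric the straight segment is longest. Hence
\<open>\<tau> x y \<le> sqrt ((1 + \<epsilon>) (\<alpha> w)\<^sup>2 - \<bar>P w\<bar>\<^sup>2)\<close> for \<open>x\<close> and \<open>y\<close> near \<open>p\<close> with coordinate difference \<open>w\<close>
(\<open>time_separation_near\<close>).

Let \<open>F u v\<close> be the summand \<open>max \<Omega> * \<tau> (\<gamma> u) (\<gamma> v)\<close>. Where \<open>\<gamma>\<close> is differentiable at \<open>t\<close>, the bound
with \<open>\<epsilon>\<close> tending to \<open>0\<close> shows that \<open>F u v / (v - u)\<close> is asymptotically at most \<open>\<Omega> * speed\<close> as \<open>u \<le> t \<le> v\<close>
shrink to \<open>t\<close> (\<open>increment_derivative\<close>); at every other \<open>t\<close> the quotient is still bounded
(\<open>increment_lipschitz\<close>). The conformal length of the restriction of \<open>\<gamma>\<close> to \<open>{a..t}\<close>, as a function of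
\<open>t\<close>, grows over \<open>{u..v}\<close> by at most \<open>F u v\<close>. Summed over a fine tagged division, where the
exceptional null set costs nothing (\<open>gauge_small_error\<close>), this bounds the conformal length by \<open>L\<close>.
\<close>

section \<open>Interval functions that are small at almost every point\<close>

text \<open>The pairs \<open>(u, v)\<close> with \<open>u \<le> t \<le> v\<close> that shrink to \<open>t\<close>. These are the intervals that a fine tagged
division of \<open>{a..b}\<close> attaches to the tag \<open>t\<close>, and a limit along this filter is a derivative at \<open>t\<close>
of an interval function.\<close>

definition straddle :: "real \<Rightarrow> real \<Rightarrow> real \<Rightarrow> (real \<times> real) filter" where
  "straddle a b t = inf (nhds (t, t)) (principal {(u, v). a \<le> u \<and> u \<le> t \<and> t \<le> v \<and> v \<le> b})"

lemma eventually_straddle: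
  "eventually P (straddle a b t) \<longleftrightarrow>
     (\<exists>\<delta>>0. \<forall>u v. a \<le> u \<and> u \<le> t \<and> t \<le> v \<and> v \<le> b \<and> dist u t < \<delta> \<and> dist v t < \<delta> \<longrightarrow> P (u, v))"
proof -
  have "eventually P (straddle a b t) \<longleftrightarrow>
    (\<exists>Q. eventually Q (nhds t) \<and>
      (\<forall>u v. Q u \<longrightarrow> Q v \<longrightarrow> a \<le> u \<and> u \<le> t \<and> t \<le> v \<and> v \<le> b \<longrightarrow> P (u, v)))"
    unfolding straddle_def eventually_inf_principal nhds_prod eventually_prod_same by auto
  also have "\<dots> \<longleftrightarrow> (\<exists>\<delta>>0. \<forall>u v. a \<le> u \<and> u \<le> t \<and> t \<le> v \<and> v \<le> b \<and> dist u t < \<delta> \<and> dist v t < \<delta>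
      \<longrightarrow> P (u, v))" (is "?l \<longleftrightarrow> ?r")
  proof
    assume ?l
    then show ?r unfolding eventually_nhds_metric by blast
  next
    assume ?r
    then obtain \<delta> where "\<delta> > 0" and *: "\<forall>u v. a \<le> u \<and> u \<le> t \<and> t \<le> v \<and> v \<le> b \<and> dist u t < \<delta> \<and> dist v t < \<delta>
      \<longrightarrow> P (u, v)" by blast
    then show ?l
      by (intro exI[of _ "\<lambda>u. dist u t < \<delta>"]) (auto simp: eventually_nhds_metric)
  qed
  finally show ?thesis .
qed

lemma straddle_members:
  "\<forall>\<^sub>F (u, v) in straddle a b t. a \<le> u \<and> u \<le> t \<and> t \<le> v \<and> v \<le> b"
  unfolding eventually_straddle by (auto intro: exI[of _ 1])

lemma straddle_mono:
  assumes "\<forall>\<^sub>F (u, v) in straddle a b t. P u v"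
    and "\<And>u v. a \<le> u \<Longrightarrow> u \<le> t \<Longrightarrow> t \<le> v \<Longrightarrow> v \<le> b \<Longrightarrow> P u v \<Longrightarrow> Q u v"
  shows "\<forall>\<^sub>F (u, v) in straddle a b t. Q u v"
  by (rule eventually_mono[OF eventually_conj[OF assms(1) straddle_members]]) (use assms(2) in auto)

lemma straddle_endpoints:
  assumes "\<forall>\<^sub>F s in at t within {a..b}. P s" "P t"
  shows "\<forall>\<^sub>F (u, v) in straddle a b t. P u \<and> P v"
proof -
  obtain \<delta> where "\<delta> > 0" "\<And>s. s \<in> {a..b} \<Longrightarrow> dist s t < \<delta> \<Longrightarrow> P s"
    using assms unfolding eventually_at by metis
  then show ?thesis unfolding eventually_straddle by (intro exI[of _ \<delta>]) auto
qed

lemma gauge_of_straddle: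
  assumes "\<And>t. t \<in> {a..b} \<Longrightarrow> eventually (\<lambda>(u, v). E t u v) (straddle a b t)"
  obtains d where "gauge d"
    "\<And>p t k. p tagged_division_of {a..b} \<Longrightarrow> d fine p \<Longrightarrow> (t, k) \<in> p \<Longrightarrow>
       t \<in> {a..b} \<and> measure lborel k = Sup k - Inf k \<and> Inf k \<le> Sup k \<and> E t (Inf k) (Sup k)"
proof -
  have "\<exists>\<delta>>0. t \<in> {a..b} \<longrightarrow>
      (\<forall>u v. a \<le> u \<and> u \<le> t \<and> t \<le> v \<and> v \<le> b \<and> dist u t < \<delta> \<and> dist v t < \<delta> \<longrightarrow> E t u v)" for t
    using assms[of t] unfolding eventually_straddle by (cases "t \<in> {a..b}") (auto intro: exI[of _ 1])
  then obtain \<delta> where \<delta>: "\<And>t. \<delta> t > 0" "\<And>t u v. t \<in> {a..b} \<Longrightarrow>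
      a \<le> u \<and> u \<le> t \<and> t \<le> v \<and> v \<le> b \<and> dist u t < \<delta> t \<and> dist v t < \<delta> t \<Longrightarrow> E t u v"
    by metis
  show thesis
  proof (rule that[of "\<lambda>t. ball t (\<delta> t)"])
    show "gauge (\<lambda>t. ball t (\<delta> t))" using \<delta>(1) by (simp add: gauge_ball_dependent)
    fix p t k
    assume p: "p tagged_division_of {a..b}" "(\<lambda>t. ball t (\<delta> t)) fine p" "(t, k) \<in> p"
    have tk: "t \<in> k" "k \<subseteq> {a..b}" using tagged_division_ofD[OF p(1)] p(3) by auto
    obtain u v where k: "k = {u..v}"
      using tagged_division_ofD(4)[OF p(1,3)] by (auto simp: box_real)
    have uv: "u \<le> t" "t \<le> v" "a \<le> u" "v \<le> b" using tk unfolding k by auto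
    have kb: "k \<subseteq> ball t (\<delta> t)" using p(2,3) unfolding fine_def by auto
    have "u \<in> ball t (\<delta> t)" "v \<in> ball t (\<delta> t)"
      using subsetD[OF kb, of u] subsetD[OF kb, of v] uv k by auto
    then have "E t u v" using uv \<delta>(2)[of t u v] by (auto simp: dist_commute)
    then show "t \<in> {a..b} \<and> measure lborel k = Sup k - Inf k \<and> Inf k \<le> Sup k \<and> E t (Inf k) (Sup k)"
      using uv k by auto
  qed
qed

text \<open>The bridge from infinitesimal estimates to sums over divisions. At the tags outside the null set
\<open>N\<close> the error \<open>E\<close> is at most \<open>\<eta>\<close> times the length, so that these tags contribute at most
\<open>\<eta> * (b - a)\<close>. At a tag \<open>t\<close> in \<open>N\<close> there is only a bound with a constant \<open>K t\<close> that depends on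
\<open>t\<close>, but the function that equals \<open>K\<close> on \<open>N\<close> and vanishes elsewhere has
gauge integral \<open>0\<close>, hence its Riemann sums over fine divisions are small.\<close>

lemma gauge_small_error:
  fixes E :: "real \<Rightarrow> real \<Rightarrow> real \<Rightarrow> real"
  assumes ab: "a \<le> b" and N: "negligible N" and \<epsilon>: "0 < \<epsilon>"
    and bad: "\<And>t. t \<in> {a..b} \<Longrightarrow> \<exists>K. \<forall>\<^sub>F (u, v) in straddle a b t. E t u v \<le> K * (v - u)"
    and good: "\<And>t \<eta>. t \<in> {a..b} - N \<Longrightarrow> 0 < \<eta> \<Longrightarrow> \<forall>\<^sub>F (u, v) in straddle a b t. E t u v \<le> \<eta> * (v - u)"
  obtains d where "gauge d"
    "\<And>p. p tagged_division_of {a..b} \<Longrightarrow> d fine p \<Longrightarrow> (\<Sum>(t, k)\<in>p. E t (Inf k) (Sup k)) \<le> \<epsilon>"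
proof -
  obtain K where K: "\<And>t. t \<in> {a..b} \<Longrightarrow> \<forall>\<^sub>F (u, v) in straddle a b t. E t u v \<le> K t * (v - u)"
    using bad by metis
  define \<kappa> where "\<kappa> t = (if t \<in> N then K t else 0)" for t
  define \<eta> where "\<eta> = \<epsilon> / (2 * (b - a + 1))"
  have \<eta>: "\<eta> > 0" "\<eta> * (b - a) \<le> \<epsilon> / 2"
    using \<epsilon> ab by (auto simp: \<eta>_def field_simps)
  have *: "\<forall>\<^sub>F (u, v) in straddle a b t. E t u v \<le> (\<kappa> t + \<eta>) * (v - u)" if t: "t \<in> {a..b}" for t
  proof (cases "t \<in> N")
    case True
    show ?thesis
    proof (rule straddle_mono[OF K[OF t]])
      fix u v assume "u \<le> t" "t \<le> v" "E t u v \<le> K t * (v - u)"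
      moreover have "0 \<le> \<eta> * (v - u)" using calculation \<eta>(1) by simp
      ultimately show "E t u v \<le> (\<kappa> t + \<eta>) * (v - u)"
        using True by (simp add: \<kappa>_def distrib_right)
    qed
  next
    case False
    then show ?thesis using good[of t \<eta>] t \<eta>(1) by (auto simp: \<kappa>_def)
  qed
  obtain d1 where d1: "gauge d1"
    "\<And>p t k. p tagged_division_of {a..b} \<Longrightarrow> d1 fine p \<Longrightarrow> (t, k) \<in> p \<Longrightarrow>
       t \<in> {a..b} \<and> measure lborel k = Sup k - Inf k \<and> Inf k \<le> Sup k \<and>
       E t (Inf k) (Sup k) \<le> (\<kappa> t + \<eta>) * (Sup k - Inf k)"
    by (rule gauge_of_straddle[OF *]) (assumption, rule that)
  have "(\<kappa> has_integral 0) {a..b}"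
    by (rule has_integral_negligible[OF N]) (auto simp: \<kappa>_def)
  then obtain d2 where d2: "gauge d2"
    "\<And>p. p tagged_division_of {a..b} \<Longrightarrow> d2 fine p \<Longrightarrow> \<bar>\<Sum>(t, k)\<in>p. measure lborel k * \<kappa> t\<bar> < \<epsilon> / 2"
    unfolding has_integral_real using \<epsilon> by (auto dest!: spec[of _ "\<epsilon> / 2"])
  show thesis
  proof (rule that)
    show "gauge (\<lambda>x. d1 x \<inter> d2 x)" using d1(1) d2(1) by (rule gauge_Int)
    fix p assume p: "p tagged_division_of {a..b}" "(\<lambda>x. d1 x \<inter> d2 x) fine p"
    then have fine: "d1 fine p" "d2 fine p" by (auto simp: fine_Int)
    have "(\<Sum>(t, k)\<in>p. E t (Inf k) (Sup k)) \<le> (\<Sum>(t, k)\<in>p. measure lborel k * \<kappa> t + \<eta> * measure lborel k)"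
    proof (intro sum_mono, clarify)
      fix t k assume "(t, k) \<in> p"
      from d1(2)[OF p(1) fine(1) this]
      have "E t (Inf k) (Sup k) \<le> (\<kappa> t + \<eta>) * measure lborel k" by metis
      then show "E t (Inf k) (Sup k) \<le> measure lborel k * \<kappa> t + \<eta> * measure lborel k"
        by (simp add: algebra_simps)
    qed
    also have "\<dots> = (\<Sum>(t, k)\<in>p. measure lborel k * \<kappa> t) + \<eta> * (\<Sum>(t, k)\<in>p. measure lborel k)"
      by (simp add: sum.distrib split_beta sum_distrib_left)
    also have "(\<Sum>(t, k)\<in>p. measure lborel k) = b - a"
      using additive_content_tagged_division[of p a b] p(1) ab by simp
    also have "(\<Sum>(t, k)\<in>p. measure lborel k * \<kappa> t) + \<eta> * (b - a) \<le> \<epsilon>"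
      using d2(2)[OF p(1) fine(2)] \<eta>(2) by linarith
    finally show "(\<Sum>(t, k)\<in>p. E t (Inf k) (Sup k)) \<le> \<epsilon>" .
  qed
qed

text \<open>A fundamental theorem of calculus for functions that are differentiable almost everywhere. The
pointwise Lipschitz condition excludes Cantor-like functions; its constant may vary
with the point, which makes the condition invariant under changes of coordinates that are merely
differentiable.\<close>

lemma has_integral_AE_derivative:
  fixes f f' :: "real \<Rightarrow> 'b::real_normed_vector"
  assumes ab: "a \<le> b" and N: "negligible N"
    and lip: "\<And>t. t \<in> {a..b} \<Longrightarrow> \<exists>K. \<forall>\<^sub>F s in at t within {a..b}. norm (f s - f t) \<le> K * \<bar>s - t\<bar>"
    and deriv: "\<And>t. t \<in> {a..b} - N \<Longrightarrow> (f has_vector_derivative f' t) (at t within {a..b})"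
  shows "(f' has_integral (f b - f a)) {a..b}"
  unfolding has_integral_real
proof (intro allI impI)
  fix \<epsilon> :: real assume "\<epsilon> > 0"
  define E where "E t u v = norm (f v - f u - (v - u) *\<^sub>R f' t)" for t u v
  have split: "\<forall>\<^sub>F (u, v) in straddle a b t. E t u v \<le> K * (v - u)"
    if "\<forall>\<^sub>F s in at t within {a..b}. norm (f s - f t - (s - t) *\<^sub>R f' t) \<le> K * \<bar>s - t\<bar>" for t K
  proof -
    from that have "\<forall>\<^sub>F (u, v) in straddle a b t.
        norm (f u - f t - (u - t) *\<^sub>R f' t) \<le> K * \<bar>u - t\<bar> \<and> norm (f v - f t - (v - t) *\<^sub>R f' t) \<le> K * \<bar>v - t\<bar>"
      by (rule straddle_endpoints) simp
    then show ?thesis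
    proof (rule straddle_mono)
      fix u v
      assume elim: "u \<le> t" "t \<le> v"
        "norm (f u - f t - (u - t) *\<^sub>R f' t) \<le> K * \<bar>u - t\<bar> \<and> norm (f v - f t - (v - t) *\<^sub>R f' t) \<le> K * \<bar>v - t\<bar>"
      have "E t u v = norm ((f v - f t - (v - t) *\<^sub>R f' t) - (f u - f t - (u - t) *\<^sub>R f' t))"
        by (simp add: E_def algebra_simps)
      also have "\<dots> \<le> norm (f v - f t - (v - t) *\<^sub>R f' t) + norm (f u - f t - (u - t) *\<^sub>R f' t)"
        by (rule norm_triangle_ineq4)
      also have "\<dots> \<le> K * (v - t) + K * (t - u)"
        using elim by (auto intro!: add_mono)
      finally show "E t u v \<le> K * (v - u)" by (simp add: algebra_simps)
    qed
  qed
  obtain d where d: "gauge d"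
    "\<And>p. p tagged_division_of {a..b} \<Longrightarrow> d fine p \<Longrightarrow> (\<Sum>(t, k)\<in>p. E t (Inf k) (Sup k)) \<le> \<epsilon> / 2"
  proof (rule gauge_small_error[OF ab N, where E = E and \<epsilon> = "\<epsilon> / 2"])
    show "\<epsilon> / 2 > 0" using \<open>\<epsilon> > 0\<close> by simp
    fix t assume t: "t \<in> {a..b}"
    obtain K where K: "\<forall>\<^sub>F s in at t within {a..b}. norm (f s - f t) \<le> K * \<bar>s - t\<bar>"
      using lip[OF t] by blast
    have "\<forall>\<^sub>F s in at t within {a..b}. norm (f s - f t - (s - t) *\<^sub>R f' t) \<le> (K + norm (f' t)) * \<bar>s - t\<bar>"
      using K
    proof eventually_elim
      case (elim s)
      have "norm (f s - f t - (s - t) *\<^sub>R f' t) \<le> norm (f s - f t) + norm ((s - t) *\<^sub>R f' t)"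
        by (rule norm_triangle_ineq4)
      then show ?case using elim by (simp add: distrib_right mult.commute[of "norm (f' t)"])
    qed
    then show "\<exists>K. \<forall>\<^sub>F (u, v) in straddle a b t. E t u v \<le> K * (v - u)" using split by blast
  next
    fix t \<eta> :: real assume t: "t \<in> {a..b} - N" and \<eta>: "0 < \<eta>"
    have "\<forall>\<^sub>F s in at t within {a..b}. norm (f s - f t - (s - t) *\<^sub>R f' t) \<le> \<eta> * \<bar>s - t\<bar>"
    proof -
      obtain \<delta> where "\<delta> > 0" "\<And>y. y \<in> {a..b} \<Longrightarrow> norm (y - t) < \<delta> \<Longrightarrow>
          norm (f y - f t - (y - t) *\<^sub>R f' t) \<le> \<eta> * norm (y - t)"
        using deriv[OF t] \<eta> unfolding has_vector_derivative_def has_derivative_within_alt by meson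
      then show ?thesis unfolding eventually_at by (auto simp: dist_real_def)
    qed
    then show "\<forall>\<^sub>F (u, v) in straddle a b t. E t u v \<le> \<eta> * (v - u)" by (rule split)
  qed (rule that)
  show "\<exists>d. gauge d \<and> (\<forall>p. p tagged_division_of {a..b} \<and> d fine p \<longrightarrow>
      norm ((\<Sum>(t, k)\<in>p. measure lborel k *\<^sub>R f' t) - (f b - f a)) < \<epsilon>)"
  proof (intro exI[of _ d] conjI allI impI d(1))
    fix p assume p: "p tagged_division_of {a..b} \<and> d fine p"
    have len: "measure lborel k = Sup k - Inf k" if "(t, k) \<in> p" for t k
      using tagged_division_ofD(2,4)[of p "{a..b}" t k] p that by (auto simp: box_real)
    have "(\<Sum>(t, k)\<in>p. measure lborel k *\<^sub>R f' t) - (f b - f a)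
        = (\<Sum>(t, k)\<in>p. measure lborel k *\<^sub>R f' t - (f (Sup k) - f (Inf k)))"
      unfolding split_beta sum_subtractf
      using additive_tagged_division_1[OF ab, of p f] p by (simp add: split_beta sum_subtractf)
    also have "norm \<dots> \<le> (\<Sum>(t, k)\<in>p. E t (Inf k) (Sup k))"
    proof (rule sum_norm_le, clarify)
      fix t k assume "(t, k) \<in> p"
      then show "norm (measure lborel k *\<^sub>R f' t - (f (Sup k) - f (Inf k))) \<le> E t (Inf k) (Sup k)"
        unfolding E_def by (simp add: len norm_minus_commute)
    qed
    also have "\<dots> \<le> \<epsilon> / 2" using d(2) p by blast
    finally show "norm ((\<Sum>(t, k)\<in>p. measure lborel k *\<^sub>R f' t) - (f b - f a)) < \<epsilon>" using \<open>\<epsilon> > 0\<close> by simp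
  qed
qed

text \<open>The one-sided counterpart: a bound on the upper derivative almost everywhere, together with
a finite upper derivative everywhere, bounds the increment.\<close>

lemma increment_le_integral:
  fixes h f :: "real \<Rightarrow> real"
  assumes ab: "a \<le> b" and N: "negligible N" and f: "(f has_integral I) {a..b}"
    and bad: "\<And>t. t \<in> {a..b} \<Longrightarrow> \<exists>K. \<forall>\<^sub>F (u, v) in straddle a b t. h v - h u \<le> K * (v - u)"
    and good: "\<And>t \<eta>. t \<in> {a..b} - N \<Longrightarrow> 0 < \<eta> \<Longrightarrow>
      \<forall>\<^sub>F (u, v) in straddle a b t. h v - h u \<le> (f t + \<eta>) * (v - u)"
  shows "h b - h a \<le> I"
proof (rule field_le_epsilon)
  fix \<epsilon> :: real assume \<epsilon>: "\<epsilon> > 0"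
  define E where "E t u v = h v - h u - f t * (v - u)" for t u v
  obtain d1 where d1: "gauge d1"
    "\<And>p. p tagged_division_of {a..b} \<Longrightarrow> d1 fine p \<Longrightarrow> (\<Sum>(t, k)\<in>p. E t (Inf k) (Sup k)) \<le> \<epsilon> / 2"
  proof (rule gauge_small_error[OF ab N, where E = E and \<epsilon> = "\<epsilon> / 2"])
    show "\<epsilon> / 2 > 0" using \<epsilon> by simp
    fix t assume t: "t \<in> {a..b}"
    obtain K where "\<forall>\<^sub>F (u, v) in straddle a b t. h v - h u \<le> K * (v - u)"
      using bad[OF t] by blast
    then show "\<exists>K. \<forall>\<^sub>F (u, v) in straddle a b t. E t u v \<le> K * (v - u)"
      by (intro exI[of _ "K - f t"]) (auto elim!: eventually_mono simp: E_def algebra_simps)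
  next
    fix t \<eta> :: real assume "t \<in> {a..b} - N" and "0 < \<eta>"
    from good[OF this] show "\<forall>\<^sub>F (u, v) in straddle a b t. E t u v \<le> \<eta> * (v - u)"
      by (auto elim!: eventually_mono simp: E_def algebra_simps)
  qed (rule that)
  obtain d2 where d2: "gauge d2"
    "\<And>p. p tagged_division_of {a..b} \<Longrightarrow> d2 fine p \<Longrightarrow> \<bar>(\<Sum>(t, k)\<in>p. measure lborel k * f t) - I\<bar> < \<epsilon> / 2"
    using f \<epsilon> unfolding has_integral_real by (auto dest!: spec[of _ "\<epsilon> / 2"])
  obtain p where p: "p tagged_division_of {a..b}" "(\<lambda>x. d1 x \<inter> d2 x) fine p"
    using fine_division_exists_real[OF gauge_Int[OF d1(1) d2(1)]] by blast
  then have fine: "d1 fine p" "d2 fine p" by (auto simp: fine_Int)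
  have len: "measure lborel k = Sup k - Inf k" if "(t, k) \<in> p" for t k
    using tagged_division_ofD(2,4)[of p "{a..b}" t k] p that by (auto simp: box_real)
  have "h b - h a = (\<Sum>(t, k)\<in>p. h (Sup k) - h (Inf k))"
    using additive_tagged_division_1[OF ab p(1), of h] by simp
  also have "\<dots> = (\<Sum>(t, k)\<in>p. E t (Inf k) (Sup k) + measure lborel k * f t)"
    by (rule sum.cong) (auto simp: E_def len)
  also have "\<dots> = (\<Sum>(t, k)\<in>p. E t (Inf k) (Sup k)) + (\<Sum>(t, k)\<in>p. measure lborel k * f t)"
    by (simp add: split_beta sum.distrib)
  also have "\<dots> \<le> I + \<epsilon>"
    using d1(2)[OF p(1) fine(1)] d2(2)[OF p(1) fine(2)] by linarith
  finally show "h b - h a \<le> I + \<epsilon>" .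
qed

lemma has_integral_Pair:
  fixes f :: "real \<Rightarrow> 'b::euclidean_space" and h :: "real \<Rightarrow> real"
  assumes "(f has_integral x) S" "(h has_integral y) S"
  shows "((\<lambda>t. (f t, h t)) has_integral (x, y)) S"
proof -
  have "bounded_linear (\<lambda>x::'b. (x, 0::real))" "bounded_linear (\<lambda>y::real. (0::'b, y))"
    by (intro bounded_linear_Pair bounded_linear_ident bounded_linear_zero)+
  from has_integral_add[OF has_integral_linear[OF assms(1) this(1)] has_integral_linear[OF assms(2) this(2)]]
  show ?thesis by (simp add: o_def)
qed

section \<open>Causal cones of nearby Lorentzian forms\<close>

lemma bilinear_expansion:
  fixes B :: "'e::euclidean_space \<Rightarrow> 'e \<Rightarrow> real"
  assumes "bilinear B"
  shows "B v w = (\<Sum>i\<in>Basis. \<Sum>j\<in>Basis. (v \<bullet> i) * (w \<bullet> j) * B i j)"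
proof -
  have "B v w = B (\<Sum>i\<in>Basis. (v \<bullet> i) *\<^sub>R i) (\<Sum>j\<in>Basis. (w \<bullet> j) *\<^sub>R j)"
    by (simp add: euclidean_representation)
  also have "\<dots> = (\<Sum>i\<in>Basis. \<Sum>j\<in>Basis. (v \<bullet> i) * (w \<bullet> j) * B i j)"
    unfolding bilinear_sum[OF assms] bilinear_lmul[OF assms] bilinear_rmul[OF assms]
    by (simp add: sum.cartesian_product mult_ac)
  finally show ?thesis .
qed

text \<open>A time coordinate \<open>\<alpha>\<close> and the projection \<open>P\<close> to a spacelike complement turn \<open>B\<close> into the
Minkowski form. The sign of \<open>\<alpha>\<close> is chosen such that the timelike vector \<open>u\<close> points to the future,
and \<open>K\<close> expresses that \<open>\<alpha>\<close> and \<open>P\<close> together are injective.\<close>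

lemma lorentzian_form_split:
  fixes B :: "'e::euclidean_space \<Rightarrow> 'e \<Rightarrow> real"
  assumes B: "lorentzian_form B" and u: "B u u < 0"
  obtains \<alpha> :: "'e \<Rightarrow> real" and P :: "'e \<Rightarrow> 'e" and K :: real
  where "linear \<alpha>" "linear P" "\<And>v w. B v w = P v \<bullet> P w - \<alpha> v * \<alpha> w"
    "K > 0" "\<And>v. norm v \<le> K * (\<bar>\<alpha> v\<bar> + norm (P v))" "norm (P u) < \<alpha> u"
proof -
  obtain f :: "'e \<Rightarrow> 'e" and e\<^sub>0 where bil: "bilinear B" and e0: "e\<^sub>0 \<in> Basis"
    and f: "\<And>i j. i \<in> Basis \<Longrightarrow> j \<in> Basis \<Longrightarrow>
      B (f i) (f j) = (if i \<noteq> j then 0 else if i = e\<^sub>0 then -1 else 1)"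
    using B unfolding lorentzian_form_def by metis
  define L where "L x = (\<Sum>i\<in>Basis. (x \<bullet> i) *\<^sub>R f i)" for x
  have linL: "linear L"
    unfolding L_def by (intro linear_compose_sum ballI linearI) (auto simp: algebra_simps)
  have BL: "B (L x) (L y) = x \<bullet> y - 2 * (x \<bullet> e\<^sub>0) * (y \<bullet> e\<^sub>0)" for x y
  proof -
    have "B (L x) (L y) = (\<Sum>i\<in>Basis. \<Sum>j\<in>Basis. (x \<bullet> i) * (y \<bullet> j) * B (f i) (f j))"
      unfolding L_def bilinear_sum[OF bil] bilinear_lmul[OF bil] bilinear_rmul[OF bil]
      by (simp add: sum.cartesian_product mult_ac)
    also have "\<dots> = (\<Sum>i\<in>Basis. \<Sum>j\<in>Basis. if j = i then (x \<bullet> i) * (y \<bullet> i) * (if i = e\<^sub>0 then -1 else 1) else 0)"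
      by (intro sum.cong refl) (auto simp: f)
    also have "\<dots> = (\<Sum>i\<in>Basis. (x \<bullet> i) * (y \<bullet> i) * (if i = e\<^sub>0 then -1 else 1))"
      by simp
    also have "\<dots> = (\<Sum>i\<in>Basis. (x \<bullet> i) * (y \<bullet> i) - (if i = e\<^sub>0 then 2 * (x \<bullet> e\<^sub>0) * (y \<bullet> e\<^sub>0) else 0))"
      by (intro sum.cong refl) auto
    also have "\<dots> = x \<bullet> y - 2 * (x \<bullet> e\<^sub>0) * (y \<bullet> e\<^sub>0)"
      using e0 by (simp add: sum_subtractf euclidean_inner[of x y])
    finally show ?thesis .
  qed
  have "inj L"
  proof (subst linear_injective_0[OF linL], safe)
    fix x assume "L x = 0"
    then have "x \<bullet> y - 2 * (x \<bullet> e\<^sub>0) * (y \<bullet> e\<^sub>0) = 0" for y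
      using BL[of x y] bilinear_lzero[OF bil] by simp
    note this[of "x - (2 * (x \<bullet> e\<^sub>0)) *\<^sub>R e\<^sub>0"]
    then have "(x - (2 * (x \<bullet> e\<^sub>0)) *\<^sub>R e\<^sub>0) \<bullet> (x - (2 * (x \<bullet> e\<^sub>0)) *\<^sub>R e\<^sub>0) = 0"
      using e0 by (simp add: algebra_simps inner_commute)
    then have x: "x = (2 * (x \<bullet> e\<^sub>0)) *\<^sub>R e\<^sub>0" by simp
    then have "x \<bullet> e\<^sub>0 = ((2 * (x \<bullet> e\<^sub>0)) *\<^sub>R e\<^sub>0) \<bullet> e\<^sub>0" by simp
    also have "\<dots> = 2 * (x \<bullet> e\<^sub>0)" using e0 by simp
    finally have "x \<bullet> e\<^sub>0 = 0" by simp
    then show "x = 0" using x by simp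
  qed
  then obtain M where M: "linear M" "\<And>x. M (L x) = x" "\<And>x. L (M x) = x"
    using linear_injective_isomorphism[OF linL] by metis
  define a where "a v = M v \<bullet> e\<^sub>0" for v
  define P where "P v = M v - (M v \<bullet> e\<^sub>0) *\<^sub>R e\<^sub>0" for v
  have lina: "linear a"
    unfolding a_def by (intro linearI) (auto simp: linear_add[OF M(1)] linear_cmul[OF M(1)] inner_simps)
  have linP: "linear P"
    unfolding P_def
    by (intro linearI) (auto simp: linear_add[OF M(1)] linear_cmul[OF M(1)] inner_simps algebra_simps)
  have form: "B v w = P v \<bullet> P w - a v * a w" for v w
    using BL[of "M v" "M w"] e0 by (simp add: M P_def a_def inner_simps inner_commute)
  have "linear (\<lambda>v. (P v, a v))"
    using linP lina by (intro linearI) (auto simp: linear_add linear_cmul)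
  moreover have "inj (\<lambda>v. (P v, a v))"
  proof (rule injI)
    fix v w assume "(P v, a v) = (P w, a w)"
    then have "M v = M w" by (auto simp: P_def a_def)
    then show "v = w" using M(3) by metis
  qed
  ultimately obtain k where k: "k > 0" "\<And>v. k * norm v \<le> norm (P v, a v)"
    by (rule linear_inj_bounded_below_pos) (rule that)
  have K: "norm v \<le> inverse k * (\<bar>a v\<bar> + norm (P v))" for v
  proof -
    have "k * norm v \<le> norm (P v) + \<bar>a v\<bar>"
      using k(2)[of v] norm_Pair_le[of "P v" "a v"] by simp
    then show ?thesis using k(1) by (simp add: field_simps)
  qed
  have "(norm (P u))\<^sup>2 < \<bar>a u\<bar>\<^sup>2"
    using u form[of u u] by (simp add: dot_square_norm power2_eq_square)
  then have "norm (P u) < \<bar>a u\<bar>"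
    by (rule power2_less_imp_less) simp
  then consider "norm (P u) < a u" | "norm (P u) < - a u" by linarith
  then show thesis
  proof cases
    case 1
    then show thesis using that[of a P "inverse k"] lina linP form k(1) K by simp
  next
    case 2
    then show thesis
      using that[of "\<lambda>v. - a v" P "inverse k"] lina linP form k(1) K
      by (simp add: linear_compose_neg)
  qed
qed

text \<open>If \<open>B'\<close> is close to the Minkowski form of \<open>\<alpha>\<close> and \<open>P\<close>, then its causal cone lies in the slightly
wider cone of the form with \<open>(1 + \<epsilon>) \<alpha>\<^sup>2\<close> in place of \<open>\<alpha>\<^sup>2\<close>, and \<open>B'\<close> measures no more proper time
than this wider form. The reason is that a \<open>B'\<close>-causal \<open>v\<close> satisfies
\<open>\<bar>P v\<bar> \<le> 2 \<bar>\<alpha> v\<bar>\<close>; the distance between the two forms on \<open>v\<close>, which is of order \<open>\<delta> \<bar>v\<bar>\<^sup>2\<close>, is then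
absorbed by \<open>\<epsilon> (\<alpha> v)\<^sup>2\<close>. That \<open>\<alpha> v\<close> is positive follows from the reverse inequality
\<open>B' u' v \<ge> 0\<close>, which holds for causal \<open>v\<close> with \<open>\<alpha> v \<le> 0\<close>.\<close>

lemma cone_perturbation:
  fixes \<alpha> :: "'e::euclidean_space \<Rightarrow> real" and P :: "'e \<Rightarrow> 'e"
  assumes lin: "linear \<alpha>" "linear P" and K: "K > 0" "\<And>v. norm v \<le> K * (\<bar>\<alpha> v\<bar> + norm (P v))"
    and u: "norm (P u) < \<alpha> u" and \<epsilon>: "\<epsilon> > 0"
  obtains \<delta> where "\<delta> > 0"
    "\<And>B' u' v. (\<And>x y. \<bar>B' x y - (P x \<bullet> P y - \<alpha> x * \<alpha> y)\<bar> \<le> \<delta> * norm x * norm y) \<Longrightarrow>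
       norm (u' - u) \<le> \<delta> \<Longrightarrow> B' v v \<le> 0 \<Longrightarrow> B' u' v < 0 \<Longrightarrow>
       0 < \<alpha> v \<and> - B' v v \<le> (1 + \<epsilon>) * (\<alpha> v)\<^sup>2 - (norm (P v))\<^sup>2"
proof -
  obtain M1 where M1: "M1 > 0" "\<And>x. norm (\<alpha> x) \<le> M1 * norm x" using linear_bounded_pos[OF lin(1)] by blast
  obtain M2 where M2: "M2 > 0" "\<And>x. norm (P x) \<le> M2 * norm x" using linear_bounded_pos[OF lin(2)] by blast
  define C where "C = M2 * M2 + M1 * M1"
  \<comment> \<open>\<open>\<kappa> \<delta>\<close> bounds the error of \<open>B' v v\<close> relative to \<open>(\<alpha> v)\<^sup>2 + \<bar>P v\<bar>\<^sup>2\<close>, and \<open>G \<delta>\<close> is the lower bound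
    of \<open>B' u' v / \<bar>\<alpha> v\<bar>\<close> for past-pointing \<open>v\<close>; at \<open>\<delta> = 0\<close> it is \<open>\<alpha> u - \<bar>P u\<bar> > 0\<close>.\<close>
  define \<kappa> where "\<kappa> \<delta> = 2 * K\<^sup>2 * \<delta>" for \<delta> :: real
  define G where "G \<delta> = \<alpha> u - norm (P u) * sqrt (1 + 3 * \<kappa> \<delta>) - 3 * K * (\<delta> * (norm u + \<delta>) + C * \<delta>)" for \<delta>
  have "(G \<longlongrightarrow> \<alpha> u - norm (P u) * sqrt (1 + 3 * (2 * K\<^sup>2 * 0)) - 3 * K * (0 * (norm u + 0) + C * 0)) (at_right 0)"
    unfolding G_def \<kappa>_def by (intro tendsto_intros)
  then have "\<forall>\<^sub>F \<delta> in at_right 0. G \<delta> > 0"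
    by (rule order_tendstoD) (use u in simp)
  moreover have "(\<kappa> \<longlongrightarrow> 2 * K\<^sup>2 * 0) (at_right 0)" unfolding \<kappa>_def by (intro tendsto_intros)
  then have "\<forall>\<^sub>F \<delta> in at_right 0. \<kappa> \<delta> < min (1 / 3) (\<epsilon> / 3)"
    by (rule order_tendstoD) (use \<epsilon> in simp)
  moreover have "\<forall>\<^sub>F \<delta> in at_right 0. (\<delta>::real) > 0" by (simp add: eventually_at_right_less)
  ultimately have "\<forall>\<^sub>F \<delta> in at_right 0. G \<delta> > 0 \<and> \<kappa> \<delta> < min (1 / 3) (\<epsilon> / 3) \<and> \<delta> > 0"
    by (intro eventually_conj)
  then obtain \<delta> where \<delta>: "G \<delta> > 0" "\<kappa> \<delta> < min (1 / 3) (\<epsilon> / 3)" "\<delta> > 0"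
    using eventually_happens'[OF trivial_limit_at_right_real] by blast
  show thesis
  proof (rule that[OF \<delta>(3)])
    fix B' :: "'e \<Rightarrow> 'e \<Rightarrow> real" and u' v
    assume near: "\<And>x y. \<bar>B' x y - (P x \<bullet> P y - \<alpha> x * \<alpha> y)\<bar> \<le> \<delta> * norm x * norm y"
      and u': "norm (u' - u) \<le> \<delta>" and v: "B' v v \<le> 0" and fut: "B' u' v < 0"
    define \<rho> where "\<rho> = (norm (P v))\<^sup>2"
    define k where "k = \<kappa> \<delta>"
    have k: "0 < k" "k < 1 / 3" "3 * k < \<epsilon>" using \<delta> K(1) by (auto simp: k_def \<kappa>_def)
    have "(norm v)\<^sup>2 \<le> (K * (\<bar>\<alpha> v\<bar> + norm (P v)))\<^sup>2"
      by (intro power_mono K) simp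
    also have "\<dots> \<le> K\<^sup>2 * (2 * (\<alpha> v)\<^sup>2 + 2 * \<rho>)"
      using sum_squares_bound[of "\<bar>\<alpha> v\<bar>" "norm (P v)"] K(1)
      by (auto simp: power_mult_distrib power2_sum \<rho>_def intro!: mult_left_mono)
    finally have "\<delta> * (norm v)\<^sup>2 \<le> \<delta> * (K\<^sup>2 * (2 * (\<alpha> v)\<^sup>2 + 2 * \<rho>))"
      using \<delta>(3) by (intro mult_left_mono) auto
    then have "\<delta> * (norm v)\<^sup>2 \<le> k * ((\<alpha> v)\<^sup>2 + \<rho>)"
      by (simp add: k_def \<kappa>_def algebra_simps)
    moreover have "\<bar>B' v v - (\<rho> - (\<alpha> v)\<^sup>2)\<bar> \<le> \<delta> * (norm v)\<^sup>2"
      using near[of v v] by (simp add: \<rho>_def dot_square_norm power2_eq_square mult.assoc)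
    ultimately have *: "\<bar>B' v v - (\<rho> - (\<alpha> v)\<^sup>2)\<bar> \<le> k * ((\<alpha> v)\<^sup>2 + \<rho>)" by linarith
    then have "\<rho> - (\<alpha> v)\<^sup>2 \<le> k * ((\<alpha> v)\<^sup>2 + \<rho>)" using v by linarith
    then have "(1 - k) * \<rho> \<le> (1 + k) * (\<alpha> v)\<^sup>2" by (simp add: algebra_simps)
    also have "\<dots> \<le> ((1 - k) * (1 + 3 * k)) * (\<alpha> v)\<^sup>2"
    proof (intro mult_right_mono)
      have "k * (3 * k) \<le> k * 1" using k by (intro mult_left_mono) auto
      then show "1 + k \<le> (1 - k) * (1 + 3 * k)" by (simp add: algebra_simps)
    qed simp
    finally have \<rho>: "\<rho> \<le> (1 + 3 * k) * (\<alpha> v)\<^sup>2" using k by (simp add: mult.assoc)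
    have "k * \<rho> \<le> k * (2 * (\<alpha> v)\<^sup>2)"
    proof (rule mult_left_mono)
      have "(1 + 3 * k) * (\<alpha> v)\<^sup>2 \<le> 2 * (\<alpha> v)\<^sup>2" using k by (intro mult_right_mono) auto
      then show "\<rho> \<le> 2 * (\<alpha> v)\<^sup>2" using \<rho> by linarith
    qed (use k in simp)
    then have "- B' v v \<le> (1 + 3 * k) * (\<alpha> v)\<^sup>2 - \<rho>"
      using * by (simp add: algebra_simps)
    also have "\<dots> \<le> (1 + \<epsilon>) * (\<alpha> v)\<^sup>2 - \<rho>"
      using k by (auto intro!: mult_right_mono)
    finally have bound: "- B' v v \<le> (1 + \<epsilon>) * (\<alpha> v)\<^sup>2 - (norm (P v))\<^sup>2" by (simp add: \<rho>_def)
    have "0 < \<alpha> v"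
    proof (rule ccontr)
      assume "\<not> 0 < \<alpha> v"
      then have a: "\<bar>\<alpha> v\<bar> = - \<alpha> v" by simp
      have Pv: "norm (P v) \<le> sqrt (1 + 3 * k) * \<bar>\<alpha> v\<bar>"
        using real_sqrt_le_mono[OF \<rho>] by (simp add: \<rho>_def real_sqrt_mult)
      also have "\<dots> \<le> 2 * \<bar>\<alpha> v\<bar>"
        using k by (intro mult_right_mono real_le_lsqrt) auto
      finally have "K * (\<bar>\<alpha> v\<bar> + norm (P v)) \<le> K * (3 * \<bar>\<alpha> v\<bar>)"
        using K(1) by (intro mult_left_mono) auto
      with K(2)[of v] have nv: "norm v \<le> 3 * K * \<bar>\<alpha> v\<bar>" by simp
      have "norm (P u) * norm (P v) \<le> norm (P u) * (sqrt (1 + 3 * k) * \<bar>\<alpha> v\<bar>)"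
        using Pv by (intro mult_left_mono) auto
      then have 1: "P u \<bullet> P v - \<alpha> u * \<alpha> v \<ge> \<bar>\<alpha> v\<bar> * (\<alpha> u - norm (P u) * sqrt (1 + 3 * k))"
        using Cauchy_Schwarz_ineq2[of "P u" "P v"] a by (auto simp: algebra_simps abs_le_iff)
      have "norm (P (u' - u)) \<le> M2 * \<delta>" "norm (\<alpha> (u' - u)) \<le> M1 * \<delta>"
        using M1 M2 u' by (meson mult_left_mono order_trans less_imp_le)+
      then have "norm (P (u' - u)) * norm (P v) \<le> (M2 * \<delta>) * (M2 * norm v)"
          "norm (\<alpha> (u' - u)) * norm (\<alpha> v) \<le> (M1 * \<delta>) * (M1 * norm v)"
        using M1 M2 \<delta>(3) by (auto intro!: mult_mono)
      then have 2: "\<bar>P (u' - u) \<bullet> P v - \<alpha> (u' - u) * \<alpha> v\<bar> \<le> C * \<delta> * norm v"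
        using Cauchy_Schwarz_ineq2[of "P (u' - u)" "P v"]
        by (simp add: C_def algebra_simps flip: abs_mult)
      have "norm u' \<le> norm u + \<delta>" using u' norm_triangle_sub[of u' u] by linarith
      then have "\<delta> * norm u' * norm v \<le> \<delta> * (norm u + \<delta>) * norm v"
        using \<delta>(3) by (intro mult_right_mono mult_left_mono) auto
      then have 3: "B' u' v \<ge> P u' \<bullet> P v - \<alpha> u' * \<alpha> v - \<delta> * (norm u + \<delta>) * norm v"
        using near[of u' v] by linarith
      have 4: "P u' = P u + P (u' - u)" "\<alpha> u' = \<alpha> u + \<alpha> (u' - u)"
        using linear_diff[OF lin(2), of u' u] linear_diff[OF lin(1), of u' u] by auto
      have "B' u' v \<ge> \<bar>\<alpha> v\<bar> * (\<alpha> u - norm (P u) * sqrt (1 + 3 * k))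
          - (\<delta> * (norm u + \<delta>) + C * \<delta>) * norm v"
        using 1 2 3 unfolding 4 by (simp add: algebra_simps)
      moreover have "(\<delta> * (norm u + \<delta>) + C * \<delta>) * norm v
          \<le> (\<delta> * (norm u + \<delta>) + C * \<delta>) * (3 * K * \<bar>\<alpha> v\<bar>)"
        using nv \<delta>(3) M1(1) M2(1) by (intro mult_left_mono add_nonneg_nonneg) (auto simp: C_def)
      ultimately have "B' u' v \<ge> \<bar>\<alpha> v\<bar> * G \<delta>"
        by (simp add: G_def k_def algebra_simps)
      moreover have "\<bar>\<alpha> v\<bar> * G \<delta> \<ge> 0" using \<delta>(1) by simp
      ultimately show False using fut by linarith
    qed
    then show "0 < \<alpha> v \<and> - B' v v \<le> (1 + \<epsilon>) * (\<alpha> v)\<^sup>2 - (norm (P v))\<^sup>2" using bound by blast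
  qed
qed

section \<open>Charts and tangent vectors\<close>

locale spacetime_atlas =
  fixes A :: "('a::{t2_space, second_countable_topology}, 'e::euclidean_space) chart set"
    and g :: "('a, 'e) metric"
    and T :: "'a \<Rightarrow> ('a, 'e) tvec"
  assumes spacetime: "spacetime A g T"
begin

abbreviation chart_metric where "chart_metric \<equiv> metric_in_chart A g"

lemma atlas: "smooth_atlas A" and metric: "lorentzian_metric A g" and orientation: "time_orientation A g T"
  using spacetime by (auto simp: spacetime_def)

lemma chart_at: obtains c where "c \<in> A" "p \<in> cdom c"
  using atlas unfolding smooth_atlas_def by blast

lemma
  assumes "c \<in> A"
  shows open_cdom: "open (cdom c)"
    and open_coord_image: "open (coord c ` cdom c)"
    and continuous_coord: "continuous_on (cdom c) (coord c)"
    and continuous_cinv: "continuous_on (coord c ` cdom c) (cinv c)"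
    and cinv_coord: "\<And>p. p \<in> cdom c \<Longrightarrow> cinv c (coord c p) = p"
  using assms atlas unfolding smooth_atlas_def is_chart_def homeomorphism_def by auto

lemma open_overlap_image:
  assumes "c \<in> A" "c' \<in> A"
  shows "open (coord c ` (cdom c \<inter> cdom c'))"
proof -
  have "coord c ` (cdom c \<inter> cdom c') = coord c ` cdom c \<inter> cinv c -` cdom c'"
    using cinv_coord[OF assms(1)] by auto
  then show ?thesis
    using continuous_open_preimage[OF continuous_cinv open_coord_image open_cdom] assms by metis
qed

lemma transition_differentiable:
  assumes "c \<in> A" "c' \<in> A" "p \<in> cdom c" "p \<in> cdom c'"
  shows "(coord c' \<circ> cinv c) differentiable (at (coord c p))"
proof -
  have "smooth_on (coord c ` (cdom c \<inter> cdom c')) (coord c' \<circ> cinv c)"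
    using atlas assms unfolding smooth_atlas_def by blast
  then have "Ck_on (Suc 0) (coord c ` (cdom c \<inter> cdom c')) (coord c' \<circ> cinv c)"
    unfolding smooth_on_def by blast
  then show ?thesis using assms by auto
qed

lemma transition_derivative:
  assumes "c \<in> A" "c' \<in> A" "p \<in> cdom c" "p \<in> cdom c'"
  shows "((coord c' \<circ> cinv c) has_derivative (\<lambda>v. chart_vector A c p v c')) (at (coord c p))"
  using transition_differentiable[OF assms] assms(2,4)
  by (simp add: chart_vector_def frechet_derivative_works)

text \<open>The chain rule for transition maps: a tangent vector does not depend on the chart
through which it is given.\<close>

lemma chart_vector_change:
  assumes "c \<in> A" "c' \<in> A" "p \<in> cdom c" "p \<in> cdom c'"
  shows "chart_vector A c' p (chart_vector A c p v c') = chart_vector A c p v"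
proof
  fix c''
  show "chart_vector A c' p (chart_vector A c p v c') c'' = chart_vector A c p v c''"
  proof (cases "c'' \<in> A \<and> p \<in> cdom c''")
    case True
    have "(coord c' \<circ> cinv c) (coord c p) = coord c' p" using cinv_coord assms by simp
    then have "((coord c'' \<circ> cinv c') has_derivative (\<lambda>v. chart_vector A c' p v c''))
        (at ((coord c' \<circ> cinv c) (coord c p)))"
      using transition_derivative[of c' c'' p] True assms by simp
    from diff_chain_at[OF transition_derivative[OF assms] this]
    have "((coord c'' \<circ> cinv c') \<circ> (coord c' \<circ> cinv c) has_derivative
        (\<lambda>v. chart_vector A c' p v c'') \<circ> (\<lambda>v. chart_vector A c p v c')) (at (coord c p))" .
    then have "(coord c'' \<circ> cinv c has_derivative
        (\<lambda>v. chart_vector A c' p v c'') \<circ> (\<lambda>v. chart_vector A c p v c')) (at (coord c p))"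
      by (rule has_derivative_transform_within_open[OF _ open_overlap_image[OF assms(1,2)]])
         (use assms in \<open>auto simp: cinv_coord[OF assms(1)] cinv_coord[OF assms(2)]\<close>)
    from has_derivative_unique[OF this transition_derivative[OF assms(1) _ assms(3)]]
    show ?thesis using True by (auto dest: fun_cong)
  qed (auto simp: chart_vector_def)
qed

lemma tangent_vector_in_chart:
  assumes "X \<in> tangent_space A p" "c \<in> A" "p \<in> cdom c"
  shows "chart_vector A c p (X c) = X"
proof -
  obtain c' v where "c' \<in> A" "p \<in> cdom c'" "X = chart_vector A c' p v"
    using assms(1) unfolding tangent_space_def by blast
  then show ?thesis using chart_vector_change[of c' c p v] assms(2,3) by simp
qed

lemma metric_in_chart_form:
  assumes "c \<in> A" "p \<in> cdom c"
  shows "lorentzian_form (chart_metric c p)"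
  using metric assms unfolding lorentzian_metric_def by blast

lemma bilinear_metric_in_chart: "c \<in> A \<Longrightarrow> p \<in> cdom c \<Longrightarrow> bilinear (chart_metric c p)"
  using metric_in_chart_form unfolding lorentzian_form_def by blast

lemma continuous_metric_in_chart:
  assumes "c \<in> A"
  shows "continuous_on (cdom c) (\<lambda>p. chart_metric c p v w)"
proof -
  have "Ck_on 0 (coord c ` cdom c) (\<lambda>x. chart_metric c (cinv c x) v w)"
    using metric assms unfolding lorentzian_metric_def smooth_on_def by blast
  then have "continuous_on (cdom c) ((\<lambda>x. chart_metric c (cinv c x) v w) \<circ> coord c)"
    by (intro continuous_on_compose continuous_coord assms) simp
  then show ?thesis
    by (rule continuous_on_eq) (use assms in \<open>auto simp: cinv_coord[OF assms]\<close>)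
qed

lemma time_orientation_in_chart:
  assumes "c \<in> A" "p \<in> cdom c"
  shows "g p (T p) (chart_vector A c p v) = chart_metric c p (T p c) v" "chart_metric c p (T p c) (T p c) < 0"
proof -
  have T: "T p \<in> tangent_space A p" "g p (T p) (T p) < 0"
    using orientation unfolding time_orientation_def by auto
  have eq: "chart_vector A c p (T p c) = T p"
    by (rule tangent_vector_in_chart[OF T(1) assms])
  show "g p (T p) (chart_vector A c p v) = chart_metric c p (T p c) v"
    by (simp add: metric_in_chart_def eq)
  show "chart_metric c p (T p c) (T p c) < 0"
    using T(2) by (simp add: metric_in_chart_def eq)
qed

text \<open>The metric coefficients are finitely many continuous functions, hence the forms at points near
\<open>p\<close> are close to the form at \<open>p\<close>, uniformly on bounded sets of vectors.\<close>

lemma metric_uniformly_near: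
  assumes c: "c \<in> A" "p \<in> cdom c" and \<delta>: "\<delta> > 0"
  shows "\<forall>\<^sub>F q in nhds p. q \<in> cdom c \<and> norm (T q c - T p c) \<le> \<delta> \<and>
    (\<forall>v w. \<bar>chart_metric c q v w - chart_metric c p v w\<bar> \<le> \<delta> * norm v * norm w)"
proof -
  define \<eta> where "\<eta> = \<delta> / (real DIM('e))\<^sup>2"
  have \<eta>: "\<eta> > 0" using \<delta> by (simp add: \<eta>_def)
  have dom: "\<forall>\<^sub>F q in nhds p. q \<in> cdom c"
    using eventually_nhds_in_open[OF open_cdom] c by blast
  have "continuous_on (cdom c) (\<lambda>q. T q c)"
    using orientation c unfolding time_orientation_def by blast
  then have "isCont (\<lambda>q. T q c) p"
    using c open_cdom continuous_on_eq_continuous_at by blast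
  then have "((\<lambda>q. T q c) \<longlongrightarrow> T p c) (nhds p)"
    using tendsto_at_iff_tendsto_nhds[of "\<lambda>q. T q c" p] by (simp add: isCont_def)
  then have nearT: "\<forall>\<^sub>F q in nhds p. dist (T q c) (T p c) < \<delta>"
    using \<delta> by (rule tendstoD)
  have "\<forall>\<^sub>F q in nhds p. \<forall>i\<in>Basis. \<forall>j\<in>Basis. dist (chart_metric c q i j) (chart_metric c p i j) < \<eta>"
  proof (intro eventually_ball_finite ballI)
    fix i j :: 'e
    have "isCont (\<lambda>q. chart_metric c q i j) p"
      using c open_cdom continuous_on_eq_continuous_at continuous_metric_in_chart by blast
    then have "((\<lambda>q. chart_metric c q i j) \<longlongrightarrow> chart_metric c p i j) (nhds p)"
      using tendsto_at_iff_tendsto_nhds[of "\<lambda>q. chart_metric c q i j" p] by (simp add: isCont_def)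
    then show "\<forall>\<^sub>F q in nhds p. dist (chart_metric c q i j) (chart_metric c p i j) < \<eta>"
      using \<eta> by (rule tendstoD)
  qed auto
  with dom nearT show ?thesis
  proof eventually_elim
    case (elim q)
    have "\<bar>chart_metric c q v w - chart_metric c p v w\<bar> \<le> \<delta> * norm v * norm w" for v w
    proof -
      have "\<bar>chart_metric c q v w - chart_metric c p v w\<bar>
          = \<bar>\<Sum>i\<in>Basis. \<Sum>j\<in>Basis. (v \<bullet> i) * (w \<bullet> j) * (chart_metric c q i j - chart_metric c p i j)\<bar>"
        using elim(1) c
        by (simp add: bilinear_expansion[OF bilinear_metric_in_chart, of c _ v w]
            sum_subtractf[symmetric] right_diff_distrib)
      also have "\<dots> \<le> (\<Sum>i\<in>(Basis::'e set). \<Sum>j\<in>(Basis::'e set). norm v * norm w * \<eta>)"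
      proof (intro order.trans[OF sum_abs] sum_mono)
        fix i j :: 'e assume ij: "i \<in> Basis" "j \<in> Basis"
        have "\<bar>v \<bullet> i\<bar> * \<bar>w \<bullet> j\<bar> * \<bar>chart_metric c q i j - chart_metric c p i j\<bar> \<le> norm v * norm w * \<eta>"
          using elim(3) ij Basis_le_norm[of i v] Basis_le_norm[of j w]
          by (intro mult_mono) (auto simp: dist_real_def intro: less_imp_le)
        then show "\<bar>(v \<bullet> i) * (w \<bullet> j) * (chart_metric c q i j - chart_metric c p i j)\<bar> \<le> norm v * norm w * \<eta>"
          by (simp add: abs_mult)
      qed
      also have "\<dots> = \<delta> * norm v * norm w"
        by (simp add: \<eta>_def power2_eq_square)
      finally show ?thesis .
    qed
    then show ?case using elim by (auto simp: dist_norm)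
  qed
qed

text \<open>The coordinates \<open>\<alpha>\<close> and \<open>P\<close> are fixed before \<open>\<epsilon>\<close> is: they diagonalise the metric at \<open>p\<close> itself,
which makes the later estimates sharp at \<open>p\<close> as \<open>\<epsilon>\<close> tends to \<open>0\<close>.\<close>

lemma cone_neighbourhood:
  assumes c: "c \<in> A" "p \<in> cdom c"
  obtains \<alpha> :: "'e \<Rightarrow> real" and P :: "'e \<Rightarrow> 'e"
  where "linear \<alpha>" "linear P" "\<And>v. chart_metric c p v v = (norm (P v))\<^sup>2 - (\<alpha> v)\<^sup>2"
    "\<And>\<epsilon>. \<epsilon> > 0 \<Longrightarrow> \<exists>U. open U \<and> p \<in> U \<and> U \<subseteq> cdom c \<and>
      (\<forall>q\<in>U. \<forall>v. chart_metric c q v v \<le> 0 \<and> chart_metric c q (T q c) v < 0 \<longrightarrow>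
         0 < \<alpha> v \<and> - chart_metric c q v v \<le> (1 + \<epsilon>) * (\<alpha> v)\<^sup>2 - (norm (P v))\<^sup>2)"
proof -
  obtain \<alpha> :: "'e \<Rightarrow> real" and P :: "'e \<Rightarrow> 'e" and K
    where lin: "linear \<alpha>" "linear P" and form: "\<And>v w. chart_metric c p v w = P v \<bullet> P w - \<alpha> v * \<alpha> w"
      and K: "K > 0" "\<And>v. norm v \<le> K * (\<bar>\<alpha> v\<bar> + norm (P v))"
      and Tp: "norm (P (T p c)) < \<alpha> (T p c)"
    by (rule lorentzian_form_split[OF metric_in_chart_form[OF c] time_orientation_in_chart(2)[OF c]])
       (rule that)
  show thesis
  proof (rule that[OF lin])
    show "chart_metric c p v v = (norm (P v))\<^sup>2 - (\<alpha> v)\<^sup>2" for v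
      by (simp add: form dot_square_norm power2_eq_square)
    fix \<epsilon> :: real assume "\<epsilon> > 0"
    obtain \<delta> where "\<delta> > 0" and \<delta>: "\<And>B' u' v. (\<And>x y. \<bar>B' x y - (P x \<bullet> P y - \<alpha> x * \<alpha> y)\<bar> \<le> \<delta> * norm x * norm y) \<Longrightarrow>
       norm (u' - T p c) \<le> \<delta> \<Longrightarrow> B' v v \<le> 0 \<Longrightarrow> B' u' v < 0 \<Longrightarrow>
       0 < \<alpha> v \<and> - B' v v \<le> (1 + \<epsilon>) * (\<alpha> v)\<^sup>2 - (norm (P v))\<^sup>2"
      using cone_perturbation[OF lin K Tp \<open>\<epsilon> > 0\<close>] by blast
    obtain U where U: "open U" "p \<in> U" "\<And>q. q \<in> U \<Longrightarrow> q \<in> cdom c \<and> norm (T q c - T p c) \<le> \<delta> \<and>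
        (\<forall>v w. \<bar>chart_metric c q v w - chart_metric c p v w\<bar> \<le> \<delta> * norm v * norm w)"
      using metric_uniformly_near[OF c \<open>\<delta> > 0\<close>] unfolding eventually_nhds by blast
    show "\<exists>U. open U \<and> p \<in> U \<and> U \<subseteq> cdom c \<and>
      (\<forall>q\<in>U. \<forall>v. chart_metric c q v v \<le> 0 \<and> chart_metric c q (T q c) v < 0 \<longrightarrow>
         0 < \<alpha> v \<and> - chart_metric c q v v \<le> (1 + \<epsilon>) * (\<alpha> v)\<^sup>2 - (norm (P v))\<^sup>2)"
    proof (intro exI[of _ U] conjI ballI allI impI)
      fix q v assume q: "q \<in> U" and v: "chart_metric c q v v \<le> 0 \<and> chart_metric c q (T q c) v < 0"
      have "0 < \<alpha> v \<and> - chart_metric c q v v \<le> (1 + \<epsilon>) * (\<alpha> v)\<^sup>2 - (norm (P v))\<^sup>2"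
        by (rule \<delta>[of "chart_metric c q" "T q c"]) (use U(3)[OF q] v in \<open>auto simp flip: form\<close>)
      then show "0 < \<alpha> v" "- chart_metric c q v v \<le> (1 + \<epsilon>) * (\<alpha> v)\<^sup>2 - (norm (P v))\<^sup>2" by blast+
    qed (use U in auto)
  qed
qed

section \<open>Causal curves\<close>

text \<open>At an interior point of its interval the velocity of a curve does not depend on the interval. With the
two-sided derivative the same integrand serves all subintervals.\<close>

definition interior_velocity :: "(real \<Rightarrow> 'a) \<Rightarrow> real \<Rightarrow> ('a, 'e) tvec" where
  "interior_velocity \<gamma> t = (\<lambda>c. if c \<in> A \<and> \<gamma> t \<in> cdom c then vector_derivative (coord c \<circ> \<gamma>) (at t) else 0)"

definition speed :: "(real \<Rightarrow> 'a) \<Rightarrow> real \<Rightarrow> real" where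
  "speed \<gamma> t = sqrt (- g (\<gamma> t) (interior_velocity \<gamma> t) (interior_velocity \<gamma> t))"

lemma velocity_interior:
  assumes "a < t" "t < b"
  shows "velocity A a b \<gamma> t = interior_velocity \<gamma> t"
  unfolding velocity_def interior_velocity_def at_within_Icc_at[OF assms] ..

definition regular_causal_at :: "(real \<Rightarrow> 'a) \<Rightarrow> real \<Rightarrow> bool" where
  "regular_causal_at \<gamma> t \<longleftrightarrow> isCont \<gamma> t \<and>
     (\<forall>c\<in>A. \<gamma> t \<in> cdom c \<longrightarrow> (coord c \<circ> \<gamma>) differentiable (at t)) \<and>
     future_causal g T (\<gamma> t) (interior_velocity \<gamma> t)"

text \<open>Differentiability in one chart gives it in all others, and the coordinate derivatives
transform like a tangent vector.\<close>

lemma coord_derivative_change: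
  assumes "isCont \<gamma> t" "c \<in> A" "\<gamma> t \<in> cdom c" "((coord c \<circ> \<gamma>) has_vector_derivative v) (at t)"
    "c' \<in> A" "\<gamma> t \<in> cdom c'"
  shows "((coord c' \<circ> \<gamma>) has_vector_derivative chart_vector A c (\<gamma> t) v c') (at t)"
proof -
  have "((coord c' \<circ> cinv c) \<circ> (coord c \<circ> \<gamma>) has_vector_derivative chart_vector A c (\<gamma> t) v c') (at t)"
  proof (rule vector_derivative_diff_chain_within[OF assms(4)], rule has_derivative_at_withinI)
    show "((coord c' \<circ> cinv c) has_derivative (\<lambda>v. chart_vector A c (\<gamma> t) v c')) (at ((coord c \<circ> \<gamma>) t))"
      using transition_derivative[OF assms(2,5,3,6)] by (simp only: comp_apply)
  qed
  moreover obtain S where "open S" "t \<in> S" "\<And>s. s \<in> S \<Longrightarrow> \<gamma> s \<in> cdom c"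
    using assms(1) eventually_nhds_in_open[OF open_cdom[OF assms(2)] assms(3)]
      tendsto_def[of \<gamma> "\<gamma> t" "nhds t"] open_cdom[OF assms(2)] assms(3)
    unfolding isCont_def tendsto_at_iff_tendsto_nhds eventually_nhds by blast
  ultimately show ?thesis
    by (elim has_vector_derivative_transform_within_open) (auto simp: cinv_coord[OF assms(2)])
qed

lemma regular_causal_in_chart:
  assumes reg: "regular_causal_at \<gamma> t" and c: "c \<in> A" "\<gamma> t \<in> cdom c"
  defines "v \<equiv> vector_derivative (coord c \<circ> \<gamma>) (at t)"
  shows "((coord c \<circ> \<gamma>) has_vector_derivative v) (at t)"
    and "chart_metric c (\<gamma> t) v v \<le> 0" "chart_metric c (\<gamma> t) (T (\<gamma> t) c) v < 0"
    and "speed \<gamma> t = sqrt (- chart_metric c (\<gamma> t) v v)"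
proof -
  show v: "((coord c \<circ> \<gamma>) has_vector_derivative v) (at t)"
    using reg c unfolding regular_causal_at_def v_def vector_derivative_works by blast
  have "interior_velocity \<gamma> t = chart_vector A c (\<gamma> t) v"
  proof
    fix c'
    show "interior_velocity \<gamma> t c' = chart_vector A c (\<gamma> t) v c'"
    proof (cases "c' \<in> A \<and> \<gamma> t \<in> cdom c'")
      case True
      then have "((coord c' \<circ> \<gamma>) has_vector_derivative chart_vector A c (\<gamma> t) v c') (at t)"
        using coord_derivative_change[OF _ c v] reg unfolding regular_causal_at_def by blast
      from vector_derivative_at[OF this] show ?thesis using True by (simp add: interior_velocity_def)
    qed (auto simp: interior_velocity_def chart_vector_def)
  qed
  then show "chart_metric c (\<gamma> t) v v \<le> 0" "chart_metric c (\<gamma> t) (T (\<gamma> t) c) v < 0" "speed \<gamma> t = sqrt (- chart_metric c (\<gamma> t) v v)"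
    using reg time_orientation_in_chart(1)[OF c, of v]
    unfolding regular_causal_at_def future_causal_def metric_in_chart_def speed_def by auto
qed

lemma regular_causal_speed_nonneg:
  assumes "regular_causal_at \<gamma> t"
  shows "speed \<gamma> t \<ge> 0"
  using assms by (simp add: regular_causal_at_def speed_def future_causal_def)

lemma causal_curve_continuous:
  assumes "causal_curve A g T a b \<gamma>"
  shows "continuous_on {a..b} \<gamma>"
  unfolding continuous_on_eq_continuous_within
proof
  fix t assume t: "t \<in> {a..b}"
  obtain c \<delta> K where c: "c \<in> A" and \<delta>: "\<delta> > 0" and dom: "\<gamma> ` ({a..b} \<inter> ball t \<delta>) \<subseteq> cdom c"
    and lip: "K-lipschitz_on ({a..b} \<inter> ball t \<delta>) (coord c \<circ> \<gamma>)"
    using assms t unfolding causal_curve_def locally_lipschitz_curve_def by meson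
  have "continuous_on ({a..b} \<inter> ball t \<delta>) (cinv c \<circ> (coord c \<circ> \<gamma>))"
    using dom by (intro continuous_on_compose[OF lipschitz_on_continuous_on[OF lip]]
        continuous_on_subset[OF continuous_cinv[OF c]]) auto
  then have "continuous_on ({a..b} \<inter> ball t \<delta>) \<gamma>"
  proof (rule continuous_on_eq)
    fix s assume "s \<in> {a..b} \<inter> ball t \<delta>"
    then have "\<gamma> s \<in> cdom c" using dom by blast
    then show "(cinv c \<circ> (coord c \<circ> \<gamma>)) s = \<gamma> s" using cinv_coord[OF c] by simp
  qed
  then have "continuous (at t within {a..b} \<inter> ball t \<delta>) \<gamma>"
    using t \<delta> by (simp add: continuous_on_eq_continuous_within)
  moreover have "at t within {a..b} \<inter> ball t \<delta> = at t within {a..b}"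
    by (rule at_within_nhd[of t "ball t \<delta>"]) (use \<delta> in auto)
  ultimately show "continuous (at t within {a..b}) \<gamma>" by simp
qed

text \<open>The definition of a causal curve provides a Lipschitz bound in some chart only. A transition map is
differentiable, so it distorts distances from a given point by a bounded factor, and the bound at
\<open>t\<close> is inherited by every chart around \<open>\<gamma> t\<close>.\<close>

lemma causal_curve_pointwise_lipschitz:
  assumes \<gamma>: "causal_curve A g T a b \<gamma>" and t: "t \<in> {a..b}" and c: "c \<in> A" "\<gamma> t \<in> cdom c"
  shows "\<exists>K. \<forall>\<^sub>F s in at t within {a..b}. norm ((coord c \<circ> \<gamma>) s - (coord c \<circ> \<gamma>) t) \<le> K * \<bar>s - t\<bar>"
proof -
  obtain c0 \<delta> K where c0: "c0 \<in> A" and \<delta>: "\<delta> > 0" and dom: "\<gamma> ` ({a..b} \<inter> ball t \<delta>) \<subseteq> cdom c0"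
    and lip: "K-lipschitz_on ({a..b} \<inter> ball t \<delta>) (coord c0 \<circ> \<gamma>)"
    using assms t unfolding causal_curve_def locally_lipschitz_curve_def by meson
  have t0: "\<gamma> t \<in> cdom c0" using dom t \<delta> by auto
  let ?\<phi> = "coord c \<circ> cinv c0" and ?x = "coord c0 (\<gamma> t)"
  obtain D where D: "(?\<phi> has_derivative D) (at ?x)"
    using transition_differentiable[OF c0 c(1) t0 c(2)] unfolding differentiable_def by blast
  obtain M where M: "\<And>h. norm (D h) \<le> norm h * M"
    using bounded_linear.bounded[OF has_derivative_bounded_linear[OF D]] by blast
  obtain r where r: "r > 0" "\<And>y. norm (y - ?x) < r \<Longrightarrow> norm (?\<phi> y - ?\<phi> ?x - D (y - ?x)) \<le> 1 * norm (y - ?x)"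
    using D unfolding has_derivative_at_alt by (meson zero_less_one)
  have \<phi>: "norm (?\<phi> y - ?\<phi> ?x) \<le> (1 + \<bar>M\<bar>) * norm (y - ?x)" if "norm (y - ?x) < r" for y
  proof -
    have "norm (?\<phi> y - ?\<phi> ?x) \<le> norm (?\<phi> y - ?\<phi> ?x - D (y - ?x)) + norm (D (y - ?x))"
      by (metis norm_triangle_sub add.commute)
    also have "\<dots> \<le> 1 * norm (y - ?x) + norm (y - ?x) * \<bar>M\<bar>"
      using M[of "y - ?x"] r(2)[OF that] mult_left_mono[OF abs_ge_self[of M] norm_ge_zero[of "y - ?x"]]
      by linarith
    finally show ?thesis by (simp add: algebra_simps)
  qed
  have "continuous_on ({a..b} \<inter> ball t \<delta>) (coord c0 \<circ> \<gamma>)" by (rule lipschitz_on_continuous_on[OF lip])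
  then obtain d where d: "d > 0" "\<And>s. s \<in> {a..b} \<inter> ball t \<delta> \<Longrightarrow> dist s t < d \<Longrightarrow> dist ((coord c0 \<circ> \<gamma>) s) ((coord c0 \<circ> \<gamma>) t) < r"
    using t \<delta> r(1) unfolding continuous_on_iff by (metis Int_iff centre_in_ball)
  have "norm ((coord c \<circ> \<gamma>) s - (coord c \<circ> \<gamma>) t) \<le> ((1 + \<bar>M\<bar>) * K) * \<bar>s - t\<bar>"
    if s: "s \<in> {a..b}" "dist s t < min d \<delta>" for s
  proof -
    have s': "s \<in> {a..b} \<inter> ball t \<delta>" using s by (auto simp: dist_commute)
    have "\<gamma> s \<in> cdom c0" using dom s' by blast
    then have "?\<phi> (coord c0 (\<gamma> s)) = coord c (\<gamma> s)" "?\<phi> ?x = coord c (\<gamma> t)"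
      using cinv_coord[OF c0] t0 by auto
    moreover have "norm (coord c0 (\<gamma> s) - ?x) < r" using d(2)[OF s'] s by (simp add: dist_norm)
    moreover have "norm (coord c0 (\<gamma> s) - ?x) \<le> K * \<bar>s - t\<bar>"
      using lipschitz_onD[OF lip s', of t] t \<delta> by (simp add: dist_norm)
    then have "(1 + \<bar>M\<bar>) * norm (coord c0 (\<gamma> s) - ?x) \<le> (1 + \<bar>M\<bar>) * (K * \<bar>s - t\<bar>)"
      by (intro mult_left_mono) auto
    ultimately show ?thesis using \<phi>[of "coord c0 (\<gamma> s)"] by (simp add: mult.assoc)
  qed
  then show ?thesis
    unfolding eventually_at using d(1) \<delta> by (intro exI[of _ "(1 + \<bar>M\<bar>) * K"] exI[of _ "min d \<delta>"]) auto
qed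

lemma causal_curve_regular:
  assumes "causal_curve A g T a b \<gamma>"
  obtains N where "negligible N" "\<And>t. t \<in> {a..b} - N \<Longrightarrow> a < t \<and> t < b \<and> regular_causal_at \<gamma> t"
proof -
  have ab: "a < b" and "AE t in lebesgue_on {a..b}.
        curve_differentiable A a b \<gamma> t \<and> future_causal g T (\<gamma> t) (velocity A a b \<gamma> t)"
    using assms unfolding causal_curve_def by auto
  then have "AE t in lebesgue. t \<in> {a..b} \<longrightarrow>
        curve_differentiable A a b \<gamma> t \<and> future_causal g T (\<gamma> t) (velocity A a b \<gamma> t)"
    by (subst (asm) AE_restrict_space_iff) auto
  then obtain N where N: "N \<in> null_sets lebesgue" "\<And>t. t \<notin> N \<Longrightarrow> t \<in> {a..b} \<Longrightarrow>
      curve_differentiable A a b \<gamma> t \<and> future_causal g T (\<gamma> t) (velocity A a b \<gamma> t)"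
    unfolding eventually_ae_filter by auto
  show thesis
  proof (rule that[of "N \<union> {a, b}"])
    show "negligible (N \<union> {a, b})" using N(1) by (simp add: negligible_iff_null_sets[symmetric])
    fix t assume "t \<in> {a..b} - (N \<union> {a, b})"
    then have t: "t \<notin> N" "t \<in> {a..b}" "a < t" "t < b" by auto
    have "isCont \<gamma> t"
      using causal_curve_continuous[OF assms] t
      by (metis at_within_Icc_at continuous_on_eq_continuous_within)
    moreover have "\<forall>c\<in>A. \<gamma> t \<in> cdom c \<longrightarrow> (coord c \<circ> \<gamma>) differentiable (at t)"
      using N(2)[OF t(1,2)] t(3,4) unfolding curve_differentiable_def by (simp add: at_within_Icc_at)
    ultimately show "a < t \<and> t < b \<and> regular_causal_at \<gamma> t"
      using N(2)[OF t(1,2)] t(3,4) unfolding regular_causal_at_def by (simp add: velocity_interior)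
  qed
qed

lemma causal_curve_restrict:
  assumes "causal_curve A g T a b \<gamma>" and "a \<le> u" "u < v" "v \<le> b"
  shows "causal_curve A g T u v \<gamma>"
proof -
  obtain N where N: "negligible N" "\<And>t. t \<in> {a..b} - N \<Longrightarrow> a < t \<and> t < b \<and> regular_causal_at \<gamma> t"
    by (rule causal_curve_regular[OF assms(1)]) (rule that)
  have "locally_lipschitz_curve A u v \<gamma>"
    unfolding locally_lipschitz_curve_def
  proof
    fix t assume "t \<in> {u..v}"
    then obtain c \<delta> K where c: "c \<in> A" "\<delta> > 0" "\<gamma> ` ({a..b} \<inter> ball t \<delta>) \<subseteq> cdom c"
      "K-lipschitz_on ({a..b} \<inter> ball t \<delta>) (coord c \<circ> \<gamma>)"
      using assms unfolding causal_curve_def locally_lipschitz_curve_def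
      by (metis (no_types, lifting) atLeastAtMost_iff order_trans)
    have sub: "{u..v} \<inter> ball t \<delta> \<subseteq> {a..b} \<inter> ball t \<delta>" using assms by auto
    show "\<exists>c\<in>A. \<exists>\<delta>>0. \<exists>K. \<gamma> ` ({u..v} \<inter> ball t \<delta>) \<subseteq> cdom c \<and>
        K-lipschitz_on ({u..v} \<inter> ball t \<delta>) (coord c \<circ> \<gamma>)"
      using c(1,2) order_trans[OF image_mono[OF sub] c(3)] lipschitz_on_subset[OF c(4) sub] by blast
  qed
  moreover have "AE t in lebesgue_on {u..v}.
        curve_differentiable A u v \<gamma> t \<and> future_causal g T (\<gamma> t) (velocity A u v \<gamma> t)"
  proof (subst AE_restrict_space_iff)
    have "N \<union> {u, v} \<in> null_sets lebesgue"
      using N(1) by (simp add: negligible_iff_null_sets[symmetric])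
    moreover have "curve_differentiable A u v \<gamma> t \<and> future_causal g T (\<gamma> t) (velocity A u v \<gamma> t)"
      if "t \<in> {u..v}" "t \<notin> N \<union> {u, v}" for t
    proof -
      have "regular_causal_at \<gamma> t" "u < t" "t < v" using that N(2)[of t] assms by auto
      then show ?thesis
        unfolding regular_causal_at_def curve_differentiable_def
        by (auto simp: at_within_Icc_at velocity_interior)
    qed
    ultimately show "AE t in lebesgue. t \<in> {u..v} \<longrightarrow>
        curve_differentiable A u v \<gamma> t \<and> future_causal g T (\<gamma> t) (velocity A u v \<gamma> t)"
      by (intro AE_I'[of "N \<union> {u, v}"]) auto
  qed auto
  ultimately show ?thesis using assms(3) unfolding causal_curve_def by blast
qed

section \<open>Lengths of short causal curves\<close>

text \<open>The reverse triangle inequality of Minkowski space, in integrated form. The coordinate velocity \<open>s\<close>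
of the curve satisfies \<open>speed\<^sup>2 + \<bar>P s\<bar>\<^sup>2 \<le> (1 + \<epsilon>) (\<alpha> s)\<^sup>2\<close>, that is, the vector \<open>(P s, speed)\<close> has
Euclidean norm at most \<open>sqrt (1 + \<epsilon>) * \<alpha> s\<close>. The norm of an integral is at most the integral of the
norm; since \<open>P\<close> and \<open>\<alpha>\<close> are linear and \<open>s\<close> integrates to \<open>w\<close>, this says
\<open>\<bar>P w\<bar>\<^sup>2 + length\<^sup>2 \<le> (1 + \<epsilon>) (\<alpha> w)\<^sup>2\<close>.\<close>

lemma length_in_cone_neighbourhood:
  fixes \<alpha> :: "'e \<Rightarrow> real" and P :: "'e \<Rightarrow> 'e"
  assumes \<sigma>: "causal_curve A g T a b \<sigma>" and U: "\<sigma> ` {a..b} \<subseteq> U" "U \<subseteq> cdom c" and c: "c \<in> A"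
    and lin: "linear \<alpha>" "linear P" and \<epsilon>: "\<epsilon> > 0"
    and cone: "\<And>q v. q \<in> U \<Longrightarrow> chart_metric c q v v \<le> 0 \<Longrightarrow> chart_metric c q (T q c) v < 0 \<Longrightarrow>
         0 < \<alpha> v \<and> - chart_metric c q v v \<le> (1 + \<epsilon>) * (\<alpha> v)\<^sup>2 - (norm (P v))\<^sup>2"
  defines "w \<equiv> coord c (\<sigma> b) - coord c (\<sigma> a)"
  shows "speed \<sigma> integrable_on {a..b}"
    and "integral {a..b} (speed \<sigma>) \<le> sqrt ((1 + \<epsilon>) * (\<alpha> w)\<^sup>2 - (norm (P w))\<^sup>2)"
proof -
  have ab: "a \<le> b" using \<sigma> by (simp add: causal_curve_def)
  have dom: "\<sigma> t \<in> cdom c" "\<sigma> t \<in> U" if "t \<in> {a..b}" for t using U that by blast+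
  obtain N where N: "negligible N" "\<And>t. t \<in> {a..b} - N \<Longrightarrow> a < t \<and> t < b \<and> regular_causal_at \<sigma> t"
    by (rule causal_curve_regular[OF \<sigma>]) (rule that)
  \<comment> \<open>The value \<open>0\<close> on \<open>N\<close> makes the cone condition hold (with equality) at every parameter.\<close>
  define s where "s t = (if t \<in> N then 0 else vector_derivative (coord c \<circ> \<sigma>) (at t))" for t
  define f where "f t = sqrt (- chart_metric c (\<sigma> t) (s t) (s t))" for t
  have "(s has_integral ((coord c \<circ> \<sigma>) b - (coord c \<circ> \<sigma>) a)) {a..b}"
  proof (rule has_integral_AE_derivative[OF ab N(1)])
    fix t assume "t \<in> {a..b}"
    then show "\<exists>K. \<forall>\<^sub>F r in at t within {a..b}. norm ((coord c \<circ> \<sigma>) r - (coord c \<circ> \<sigma>) t) \<le> K * \<bar>r - t\<bar>"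
      using causal_curve_pointwise_lipschitz[OF \<sigma> _ c] dom by blast
  next
    fix t assume t: "t \<in> {a..b} - N"
    then have "((coord c \<circ> \<sigma>) has_vector_derivative s t) (at t)"
      using regular_causal_in_chart(1)[OF _ c] N(2)[OF t] dom by (simp add: s_def)
    then show "((coord c \<circ> \<sigma>) has_vector_derivative s t) (at t within {a..b})"
      by (rule has_vector_derivative_at_within)
  qed
  then have s: "(s has_integral w) {a..b}" by (simp add: w_def)
  have \<alpha>s: "((\<lambda>t. \<alpha> (s t)) has_integral \<alpha> w) {a..b}"
    using has_integral_linear[OF s linear_linear[THEN iffD2, OF lin(1)]] by (simp add: o_def)
  have Ps: "((\<lambda>t. P (s t)) has_integral P w) {a..b}"
    using has_integral_linear[OF s linear_linear[THEN iffD2, OF lin(2)]] by (simp add: o_def)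
  have f_eq: "speed \<sigma> t = f t" if "t \<in> {a..b} - N" for t
    using regular_causal_in_chart(4)[OF _ c] N(2)[OF that] dom that by (simp add: s_def f_def)
  have s_cone: "0 \<le> f t \<and> 0 \<le> \<alpha> (s t) \<and> (f t)\<^sup>2 + (norm (P (s t)))\<^sup>2 \<le> (1 + \<epsilon>) * (\<alpha> (s t))\<^sup>2"
    if t: "t \<in> {a..b}" for t
  proof (cases "t \<in> N")
    case True
    then show ?thesis
      using bilinear_lzero[OF bilinear_metric_in_chart[OF c dom(1)[OF t]]]
      by (simp add: f_def s_def linear_0[OF lin(1)] linear_0[OF lin(2)])
  next
    case False
    then have "regular_causal_at \<sigma> t" using N(2)[of t] t by blast
    from regular_causal_in_chart(2,3)[OF this c dom(1)[OF t]]
    have "chart_metric c (\<sigma> t) (s t) (s t) \<le> 0" "chart_metric c (\<sigma> t) (T (\<sigma> t) c) (s t) < 0"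
      using False by (auto simp: s_def)
    with cone[OF dom(2)[OF t] this] show ?thesis by (simp add: f_def)
  qed
  have f_meas: "f \<in> borel_measurable (lebesgue_on {a..b})"
  proof -
    have [measurable]: "s \<in> borel_measurable (lebesgue_on {a..b})"
      using s by (intro integrable_imp_measurable) blast
    have [measurable]: "(\<lambda>t. chart_metric c (\<sigma> t) i j) \<in> borel_measurable (lebesgue_on {a..b})" for i j
    proof (rule continuous_imp_measurable_on_sets_lebesgue)
      show "continuous_on {a..b} (\<lambda>t. chart_metric c (\<sigma> t) i j)"
        using continuous_on_compose2[OF continuous_metric_in_chart[OF c] causal_curve_continuous[OF \<sigma>]] U
        by (meson order_trans)
    qed simp
    have "(\<lambda>t. sqrt (- (\<Sum>i\<in>Basis. \<Sum>j\<in>Basis. (s t \<bullet> i) * (s t \<bullet> j) * chart_metric c (\<sigma> t) i j)))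
        \<in> borel_measurable (lebesgue_on {a..b})"
      by measurable
    moreover have "f t = sqrt (- (\<Sum>i\<in>Basis. \<Sum>j\<in>Basis. (s t \<bullet> i) * (s t \<bullet> j) * chart_metric c (\<sigma> t) i j))"
      if "t \<in> space (lebesgue_on {a..b})" for t
      using that dom unfolding f_def by (subst bilinear_expansion[OF bilinear_metric_in_chart[OF c]]) auto
    ultimately show ?thesis by (subst measurable_cong) auto
  qed
  have bound: "norm (P (s t), f t) \<le> sqrt (1 + \<epsilon>) * \<alpha> (s t)" if "t \<in> {a..b}" for t
  proof -
    have "norm (P (s t), f t) = sqrt ((f t)\<^sup>2 + (norm (P (s t)))\<^sup>2)" by (simp add: norm_Pair add.commute)
    also have "\<dots> \<le> sqrt ((1 + \<epsilon>) * (\<alpha> (s t))\<^sup>2)" using s_cone[OF that] by simp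
    also have "\<dots> = sqrt (1 + \<epsilon>) * \<alpha> (s t)" using s_cone[OF that] by (simp add: real_sqrt_mult)
    finally show ?thesis .
  qed
  have \<alpha>s': "((\<lambda>t. sqrt (1 + \<epsilon>) * \<alpha> (s t)) has_integral sqrt (1 + \<epsilon>) * \<alpha> w) {a..b}"
    using has_integral_mult_right[OF \<alpha>s] by simp
  have f_int: "f integrable_on {a..b}"
  proof (rule measurable_bounded_by_integrable_imp_integrable[OF f_meas])
    show "(\<lambda>t. sqrt (1 + \<epsilon>) * \<alpha> (s t)) integrable_on {a..b}" using \<alpha>s' by blast
    show "norm (f t) \<le> sqrt (1 + \<epsilon>) * \<alpha> (s t)" if "t \<in> {a..b}" for t
      using bound[OF that] norm_snd_le[of "f t" "P (s t)"] by simp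
  qed simp
  show "speed \<sigma> integrable_on {a..b}"
    using integrable_spike[OF f_int N(1)] f_eq by blast
  define I where "I = integral {a..b} f"
  have I: "integral {a..b} (speed \<sigma>) = I"
    unfolding I_def using f_eq by (intro integral_spike[OF N(1)]) auto
  have "(f has_integral I) {a..b}" using f_int unfolding I_def by blast
  from has_integral_Pair[OF Ps this]
  have PI: "((\<lambda>t. (P (s t), f t)) has_integral (P w, I)) {a..b}" .
  then have "norm (integral {a..b} (\<lambda>t. (P (s t), f t))) \<le> integral {a..b} (\<lambda>t. sqrt (1 + \<epsilon>) * \<alpha> (s t))"
    using \<alpha>s' bound by (intro Henstock_Kurzweil_Integration.integral_norm_bound_integral) auto
  then have "norm (P w, I) \<le> sqrt (1 + \<epsilon>) * \<alpha> w"
    by (simp only: integral_unique[OF PI] integral_unique[OF \<alpha>s'])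
  then have "(norm (P w, I))\<^sup>2 \<le> (sqrt (1 + \<epsilon>) * \<alpha> w)\<^sup>2"
    by (intro power_mono) auto
  then have "I\<^sup>2 \<le> (1 + \<epsilon>) * (\<alpha> w)\<^sup>2 - (norm (P w))\<^sup>2"
    using \<epsilon> by (simp add: norm_Pair power_mult_distrib)
  then show "integral {a..b} (speed \<sigma>) \<le> sqrt ((1 + \<epsilon>) * (\<alpha> w)\<^sup>2 - (norm (P w))\<^sup>2)"
    unfolding I by (rule real_le_rsqrt)
qed

lemma speed_integrable:
  assumes \<gamma>: "causal_curve A g T a b \<gamma>"
  shows "speed \<gamma> integrable_on {a..b}"
proof -
  have "\<forall>t\<in>cbox a b. \<exists>d>0. \<forall>u v. t \<in> cbox u v \<and> cbox u v \<subseteq> ball t d \<and> cbox u v \<subseteq> cbox a b \<longrightarrow>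
      speed \<gamma> integrable_on cbox u v"
  proof
    fix t assume "t \<in> cbox a b"
    then have t: "t \<in> {a..b}" by simp
    obtain c where c: "c \<in> A" "\<gamma> t \<in> cdom c" by (rule chart_at)
    obtain \<alpha> :: "'e \<Rightarrow> real" and P :: "'e \<Rightarrow> 'e" and U
      where lin: "linear \<alpha>" "linear P" and U: "open U" "\<gamma> t \<in> U" "U \<subseteq> cdom c"
        and cone: "\<And>q v. q \<in> U \<Longrightarrow> chart_metric c q v v \<le> 0 \<Longrightarrow> chart_metric c q (T q c) v < 0 \<Longrightarrow>
         0 < \<alpha> v \<and> - chart_metric c q v v \<le> (1 + 1) * (\<alpha> v)\<^sup>2 - (norm (P v))\<^sup>2"
      by (rule cone_neighbourhood[OF c]) (metis zero_less_one)
    have "\<forall>\<^sub>F r in at t within {a..b}. \<gamma> r \<in> U"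
      using causal_curve_continuous[OF \<gamma>] t U unfolding continuous_on_def by (metis topological_tendstoD)
    then obtain d where d: "d > 0" "\<And>r. r \<in> {a..b} \<Longrightarrow> dist r t < d \<Longrightarrow> \<gamma> r \<in> U"
      using U(2) unfolding eventually_at by metis
    have "speed \<gamma> integrable_on {u..v}" if uv: "t \<in> {u..v}" "{u..v} \<subseteq> ball t d" "{u..v} \<subseteq> {a..b}" for u v
    proof (cases "u < v")
      case True
      then have "causal_curve A g T u v \<gamma>" using uv by (intro causal_curve_restrict[OF \<gamma>]) auto
      moreover have "\<gamma> ` {u..v} \<subseteq> U" using uv d(2) by (force simp: dist_commute)
      ultimately show ?thesis
        using length_in_cone_neighbourhood(1)[OF _ _ U(3) c(1) lin zero_less_one cone] by blast
    next
      case False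
      then have "u = v" using uv by auto
      then show ?thesis using integrable_on_refl[of "speed \<gamma>" u] by simp
    qed
    then show "\<exists>d>0. \<forall>u v. t \<in> cbox u v \<and> cbox u v \<subseteq> ball t d \<and> cbox u v \<subseteq> cbox a b \<longrightarrow>
      speed \<gamma> integrable_on cbox u v" using d(1) by (intro exI[of _ d]) simp
  qed
  from integrable_on_little_subintervals[OF this] show ?thesis by simp
qed

text \<open>Lengths are Lebesgue integrals of an extended real integrand; as the speed is nonnegative
almost everywhere, they agree with the gauge integrals used in the estimates.\<close>

lemma weighted_length:
  assumes \<gamma>: "causal_curve A g T a b \<gamma>" and \<Omega>: "continuous_on {a..b} \<Omega>" "\<And>t. t \<in> {a..b} \<Longrightarrow> 0 \<le> \<Omega> t"
  shows "(\<lambda>t. \<Omega> t * speed \<gamma> t) integrable_on {a..b}"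
    and "(\<integral>\<^sup>+t. ennreal (\<Omega> t * sqrt (- g (\<gamma> t) (velocity A a b \<gamma> t) (velocity A a b \<gamma> t)))
        \<partial>lebesgue_on {a..b}) = ennreal (integral {a..b} (\<lambda>t. \<Omega> t * speed \<gamma> t))"
proof -
  obtain N where N: "negligible N" "\<And>t. t \<in> {a..b} - N \<Longrightarrow> a < t \<and> t < b \<and> regular_causal_at \<gamma> t"
    by (rule causal_curve_regular[OF \<gamma>]) (rule that)
  define f where "f t = (if t \<in> N then 0 else speed \<gamma> t)" for t
  have f_nonneg: "0 \<le> f t" if "t \<in> {a..b}" for t
    using that N(2)[of t] regular_causal_speed_nonneg by (auto simp: f_def)
  have "f integrable_on {a..b}"
    by (rule integrable_spike[OF speed_integrable[OF \<gamma>] N(1)]) (simp add: f_def)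
  then have "f absolutely_integrable_on {a..b}"
    using f_nonneg by (rule nonnegative_absolutely_integrable_1)
  then have "(\<lambda>t. \<Omega> t * f t) absolutely_integrable_on {a..b}"
    using \<Omega>(1) by (intro absolutely_integrable_bounded_measurable_product_real
        continuous_imp_measurable_on_sets_lebesgue compact_imp_bounded compact_continuous_image) auto
  then have int: "(\<lambda>t. \<Omega> t * f t) integrable_on {a..b}"
    by (rule set_lebesgue_integral_eq_integral)
  show "(\<lambda>t. \<Omega> t * speed \<gamma> t) integrable_on {a..b}"
    by (rule integrable_spike[OF int N(1)]) (simp add: f_def)
  have "(\<integral>\<^sup>+t. ennreal (\<Omega> t * sqrt (- g (\<gamma> t) (velocity A a b \<gamma> t) (velocity A a b \<gamma> t))) \<partial>lebesgue_on {a..b})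
      = (\<integral>\<^sup>+t. ennreal (\<Omega> t * f t) \<partial>lebesgue_on {a..b})"
  proof (rule nn_integral_cong_AE, subst AE_restrict_space_iff)
    have "N \<in> null_sets lebesgue" using N(1) by (simp add: negligible_iff_null_sets)
    moreover have "ennreal (\<Omega> t * sqrt (- g (\<gamma> t) (velocity A a b \<gamma> t) (velocity A a b \<gamma> t))) = ennreal (\<Omega> t * f t)"
      if "t \<in> {a..b}" "t \<notin> N" for t
      using N(2)[of t] that by (simp add: f_def speed_def velocity_interior)
    ultimately show "AE t in lebesgue. t \<in> {a..b} \<longrightarrow>
        ennreal (\<Omega> t * sqrt (- g (\<gamma> t) (velocity A a b \<gamma> t) (velocity A a b \<gamma> t))) = ennreal (\<Omega> t * f t)"
      by (intro AE_I'[of N]) auto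
  qed simp
  also have "\<dots> = (\<integral>\<^sup>+t. ennreal (\<Omega> t * f t) * indicator {a..b} t \<partial>lborel)"
    by (subst nn_integral_restrict_space) (simp_all add: nn_integral_completion)
  also have "\<dots> = ennreal (integral {a..b} (\<lambda>t. \<Omega> t * f t))"
    by (rule nn_integral_has_integral_lebesgue')
       (use \<Omega>(2) f_nonneg int in \<open>auto intro: integrable_integral\<close>)
  also have "integral {a..b} (\<lambda>t. \<Omega> t * f t) = integral {a..b} (\<lambda>t. \<Omega> t * speed \<gamma> t)"
    by (rule integral_spike[OF N(1)]) (simp add: f_def)
  finally show "(\<integral>\<^sup>+t. ennreal (\<Omega> t * sqrt (- g (\<gamma> t) (velocity A a b \<gamma> t) (velocity A a b \<gamma> t)))
        \<partial>lebesgue_on {a..b}) = ennreal (integral {a..b} (\<lambda>t. \<Omega> t * speed \<gamma> t))" .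
qed

lemma metric_length_speed:
  assumes "causal_curve A g T a b \<gamma>"
  shows "metric_length A g a b \<gamma> = ennreal (integral {a..b} (speed \<gamma>))"
  using weighted_length(2)[OF assms, of "\<lambda>_. 1"] by (simp add: metric_length_def)

lemma length_le_time_separation:
  assumes "causal_curve A g T a b \<gamma>"
  shows "metric_length A g a b \<gamma> \<le> time_separation A g T (\<gamma> a) (\<gamma> b)"
  unfolding time_separation_def using assms by (intro Sup_upper) auto

text \<open>Strong causality confines every causal curve between two points of
\<open>V\<close>, however long, to the neighbourhood in which the cones are controlled.\<close>

lemma time_separation_near:
  assumes sc: "strongly_causal A g T" and c: "c \<in> A" "p \<in> cdom c"
  obtains \<alpha> :: "'e \<Rightarrow> real" and P :: "'e \<Rightarrow> 'e"
  where "linear \<alpha>" "linear P" "\<And>v. chart_metric c p v v = (norm (P v))\<^sup>2 - (\<alpha> v)\<^sup>2"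
    "\<And>\<epsilon>. \<epsilon> > 0 \<Longrightarrow> \<exists>V. open V \<and> p \<in> V \<and> (\<forall>x\<in>V. \<forall>y\<in>V. time_separation A g T x y \<le>
      ennreal (sqrt ((1 + \<epsilon>) * (\<alpha> (coord c y - coord c x))\<^sup>2 - (norm (P (coord c y - coord c x)))\<^sup>2)))"
proof -
  obtain \<alpha> :: "'e \<Rightarrow> real" and P :: "'e \<Rightarrow> 'e"
  where lin: "linear \<alpha>" "linear P" and form: "\<And>v. chart_metric c p v v = (norm (P v))\<^sup>2 - (\<alpha> v)\<^sup>2"
    and cone: "\<And>\<epsilon>. \<epsilon> > 0 \<Longrightarrow> \<exists>U. open U \<and> p \<in> U \<and> U \<subseteq> cdom c \<and>
      (\<forall>q\<in>U. \<forall>v. chart_metric c q v v \<le> 0 \<and> chart_metric c q (T q c) v < 0 \<longrightarrow>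
         0 < \<alpha> v \<and> - chart_metric c q v v \<le> (1 + \<epsilon>) * (\<alpha> v)\<^sup>2 - (norm (P v))\<^sup>2)"
    by (rule cone_neighbourhood[OF c]) (rule that)
  show thesis
  proof (rule that[OF lin form])
    fix \<epsilon> :: real assume \<epsilon>: "\<epsilon> > 0"
    from cone[OF \<epsilon>] obtain U where U: "open U" "p \<in> U" "U \<subseteq> cdom c"
      and U_cone: "\<And>q v. q \<in> U \<Longrightarrow> chart_metric c q v v \<le> 0 \<Longrightarrow> chart_metric c q (T q c) v < 0 \<Longrightarrow>
         0 < \<alpha> v \<and> - chart_metric c q v v \<le> (1 + \<epsilon>) * (\<alpha> v)\<^sup>2 - (norm (P v))\<^sup>2"
      by blast
    obtain V where V: "V \<subseteq> U" "open V" "p \<in> V"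
      "\<And>a b \<sigma>. causal_curve A g T a b \<sigma> \<Longrightarrow> \<sigma> a \<in> V \<Longrightarrow> \<sigma> b \<in> V \<Longrightarrow> \<sigma> ` {a..b} \<subseteq> U"
      using sc U(1,2) unfolding strongly_causal_def by metis
    have "time_separation A g T x y \<le>
      ennreal (sqrt ((1 + \<epsilon>) * (\<alpha> (coord c y - coord c x))\<^sup>2 - (norm (P (coord c y - coord c x)))\<^sup>2))"
      if xy: "x \<in> V" "y \<in> V" for x y
      unfolding time_separation_def
    proof (rule Sup_least, safe)
      fix a b \<sigma> assume \<sigma>: "causal_curve A g T a b \<sigma>" and x: "x = \<sigma> a" and y: "y = \<sigma> b"
      have "\<sigma> ` {a..b} \<subseteq> U" using V(4)[OF \<sigma>] xy x y by simp
      from length_in_cone_neighbourhood(2)[OF \<sigma> this U(3) c(1) lin \<epsilon> U_cone]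
      show "metric_length A g a b \<sigma> \<le> ennreal (sqrt ((1 + \<epsilon>) * (\<alpha> (coord c (\<sigma> b) - coord c (\<sigma> a)))\<^sup>2
          - (norm (P (coord c (\<sigma> b) - coord c (\<sigma> a))))\<^sup>2))"
        unfolding metric_length_speed[OF \<sigma>] by (intro ennreal_leI) auto
    qed simp
    then show "\<exists>V. open V \<and> p \<in> V \<and> (\<forall>x\<in>V. \<forall>y\<in>V. time_separation A g T x y \<le>
      ennreal (sqrt ((1 + \<epsilon>) * (\<alpha> (coord c y - coord c x))\<^sup>2 - (norm (P (coord c y - coord c x)))\<^sup>2)))"
      using V(2,3) by blast
  qed
qed

section \<open>The conformal length functional\<close>

abbreviation conformal_increment :: "('a \<Rightarrow> real) \<Rightarrow> (real \<Rightarrow> 'a) \<Rightarrow> real \<Rightarrow> real \<Rightarrow> ennreal" where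
  "conformal_increment \<Omega> \<gamma> u v \<equiv>
     ennreal (SUP s\<in>{u..v}. \<Omega> (\<gamma> s)) * time_separation A g T (\<gamma> u) (\<gamma> v)"

lemma smooth_function_continuous:
  assumes "smooth_function A f"
  shows "continuous_on UNIV f"
proof (rule continuous_at_imp_continuous_on, rule ballI)
  fix p
  obtain c where c: "c \<in> A" "p \<in> cdom c" by (rule chart_at)
  have "Ck_on 0 (coord c ` cdom c) (f \<circ> cinv c)"
    using assms c unfolding smooth_function_def smooth_on_def by blast
  then have "continuous_on (cdom c) ((f \<circ> cinv c) \<circ> coord c)"
    by (intro continuous_on_compose[OF continuous_coord[OF c(1)]]) simp
  then have "continuous_on (cdom c) f"
    by (rule continuous_on_eq) (simp add: cinv_coord[OF c(1)])
  then show "isCont f p"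
    using c open_cdom continuous_on_eq_continuous_at by blast
qed

text \<open>On each piece \<open>\<Omega>\<close> is at most its maximum, and the curve itself is a competitor for the time
separation of its end points.\<close>

lemma weighted_length_le_increment:
  assumes \<gamma>: "causal_curve A g T u v \<gamma>" and \<Omega>: "continuous_on UNIV \<Omega>" "\<And>p. \<Omega> p > 0"
  shows "ennreal (integral {u..v} (\<lambda>t. \<Omega> (\<gamma> t) * speed \<gamma> t)) \<le> conformal_increment \<Omega> \<gamma> u v"
proof -
  have uv: "u < v" using \<gamma> by (simp add: causal_curve_def)
  have cont: "continuous_on {u..v} (\<lambda>t. \<Omega> (\<gamma> t))"
    using continuous_on_compose2[OF \<Omega>(1) causal_curve_continuous[OF \<gamma>]] by simp
  then have bdd: "bdd_above ((\<lambda>t. \<Omega> (\<gamma> t)) ` {u..v})"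
    by (intro bounded_imp_bdd_above compact_imp_bounded compact_continuous_image) auto
  define M where "M = (SUP s\<in>{u..v}. \<Omega> (\<gamma> s))"
  have le_M: "\<Omega> (\<gamma> t) \<le> M" if "t \<in> {u..v}" for t
    unfolding M_def using that bdd by (rule cSUP_upper)
  have "M \<ge> 0" using le_M[of u] \<Omega>(2)[of "\<gamma> u"] uv by simp
  let ?q = "\<lambda>t. sqrt (- g (\<gamma> t) (velocity A u v \<gamma> t) (velocity A u v \<gamma> t))"
  have "ennreal (integral {u..v} (\<lambda>t. \<Omega> (\<gamma> t) * speed \<gamma> t))
      = (\<integral>\<^sup>+t. ennreal (\<Omega> (\<gamma> t) * ?q t) \<partial>lebesgue_on {u..v})"
    using weighted_length(2)[OF \<gamma> cont] \<Omega>(2) by (simp add: less_imp_le)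
  also have "\<dots> \<le> (\<integral>\<^sup>+t. ennreal (M * ?q t) \<partial>lebesgue_on {u..v})"
  proof (rule nn_integral_mono)
    fix t assume "t \<in> space (lebesgue_on {u..v})"
    then have t: "t \<in> {u..v}" by simp
    show "ennreal (\<Omega> (\<gamma> t) * ?q t) \<le> ennreal (M * ?q t)"
    proof (cases "?q t \<ge> 0")
      case True
      then show ?thesis by (intro ennreal_leI mult_right_mono le_M t)
    next
      case False
      then have "\<Omega> (\<gamma> t) * ?q t \<le> 0" using \<Omega>(2)[of "\<gamma> t"] by (intro mult_nonneg_nonpos) auto
      then show ?thesis by (simp add: ennreal_neg)
    qed
  qed
  also have "\<dots> = ennreal (integral {u..v} (\<lambda>t. M * speed \<gamma> t))"
    using weighted_length(2)[OF \<gamma>, of "\<lambda>_. M"] \<open>M \<ge> 0\<close> by simp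
  also have "\<dots> = ennreal M * metric_length A g u v \<gamma>"
    using \<open>M \<ge> 0\<close> by (simp add: metric_length_speed[OF \<gamma>] ennreal_mult')
  also have "\<dots> \<le> ennreal M * time_separation A g T (\<gamma> u) (\<gamma> v)"
    by (intro mult_left_mono length_le_time_separation \<gamma>) simp
  finally show ?thesis by (simp add: M_def)
qed

lemma ennreal_add_le: "ennreal (x + y) \<le> ennreal x + ennreal y"
  by (cases "0 \<le> x"; cases "0 \<le> y") (auto simp: ennreal_neg ennreal_leI)

lemma weighted_length_le_conformal_length:
  assumes \<gamma>: "causal_curve A g T a b \<gamma>" and \<Omega>: "continuous_on UNIV \<Omega>" "\<And>p. \<Omega> p > 0"
  shows "ennreal (integral {a..b} (\<lambda>t. \<Omega> (\<gamma> t) * speed \<gamma> t))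
    \<le> conformal_length (time_separation A g T) \<Omega> a b \<gamma>"
  unfolding conformal_length_def
proof (rule Inf_greatest, safe)
  fix t :: "nat \<Rightarrow> real" and m
  assume a: "a = t 0" and b: "b = t m" and step: "\<forall>i<m. t i < t (Suc i)"
  have mono: "t i \<le> t j" if "i \<le> j" "j \<le> m" for i j
    using that
  proof (induction j rule: dec_induct)
    case (step j)
    then show ?case using \<open>\<forall>i<m. t i < t (Suc i)\<close> by (meson Suc_leD Suc_le_lessD less_imp_le order_trans)
  qed simp
  have int: "(\<lambda>t. \<Omega> (\<gamma> t) * speed \<gamma> t) integrable_on {a..b}"
  proof (rule weighted_length(1)[OF \<gamma>])
    show "continuous_on {a..b} (\<lambda>t. \<Omega> (\<gamma> t))"
      using continuous_on_compose2[OF \<Omega>(1) causal_curve_continuous[OF \<gamma>]] by simp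
  qed (simp add: \<Omega>(2) less_imp_le)
  have "ennreal (integral {t 0..t k} (\<lambda>t. \<Omega> (\<gamma> t) * speed \<gamma> t))
      \<le> (\<Sum>i<k. conformal_increment \<Omega> \<gamma> (t i) (t (Suc i)))" if "k \<le> m" for k
    using that
  proof (induction k)
    case (Suc k)
    let ?h = "\<lambda>t. \<Omega> (\<gamma> t) * speed \<gamma> t"
    have k: "t 0 \<le> t k" "t k < t (Suc k)" "t (Suc k) \<le> t m" using Suc.prems step mono by auto
    then have "causal_curve A g T (t k) (t (Suc k)) \<gamma>"
      using causal_curve_restrict[OF \<gamma>] a b by simp
    note inc = weighted_length_le_increment[OF this \<Omega>]
    have "?h integrable_on {t 0..t (Suc k)}"
      by (rule integrable_on_subinterval[OF int]) (use k a b in auto)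
    then have "integral {t 0..t (Suc k)} ?h = integral {t 0..t k} ?h + integral {t k..t (Suc k)} ?h"
      using k by (intro Henstock_Kurzweil_Integration.integral_combine[symmetric]) auto
    also have "ennreal \<dots> \<le> ennreal (integral {t 0..t k} ?h) + ennreal (integral {t k..t (Suc k)} ?h)"
      by (rule ennreal_add_le)
    also have "\<dots> \<le> (\<Sum>i<k. conformal_increment \<Omega> \<gamma> (t i) (t (Suc i))) + conformal_increment \<Omega> \<gamma> (t k) (t (Suc k))"
      using Suc inc by (intro add_mono) auto
    finally show ?case by simp
  qed simp
  from this[of m] show "ennreal (integral {t 0..t m} (\<lambda>t. \<Omega> (\<gamma> t) * speed \<gamma> t))
      \<le> (\<Sum>i<m. conformal_increment \<Omega> \<gamma> (t i) (t (Suc i)))" by simp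
qed

lemma conformal_length_refl: "conformal_length \<tau> \<Omega> a a \<gamma> = 0"
proof -
  have "conformal_length \<tau> \<Omega> a a \<gamma> \<le> (\<Sum>i<(0::nat). 0)"
    unfolding conformal_length_def by (rule Inf_lower) (force intro!: exI[of _ 0] exI[of _ "\<lambda>_. a"])
  then show ?thesis by simp
qed

text \<open>A partition of \<open>{a..u}\<close> and the single interval \<open>{u..v}\<close> form a partition of \<open>{a..v}\<close>.\<close>

lemma conformal_length_extend:
  assumes "u < v"
  shows "conformal_length (time_separation A g T) \<Omega> a v \<gamma>
    \<le> conformal_length (time_separation A g T) \<Omega> a u \<gamma> + conformal_increment \<Omega> \<gamma> u v"
proof (cases "conformal_increment \<Omega> \<gamma> u v = top")
  case False
  let ?V = "conformal_length (time_separation A g T) \<Omega> a"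
  have "?V v \<gamma> - conformal_increment \<Omega> \<gamma> u v \<le> ?V u \<gamma>"
    unfolding conformal_length_def[of _ _ _ u]
  proof (rule Inf_greatest, elim CollectE exE conjE)
    fix S and t :: "nat \<Rightarrow> real" and m
    assume S: "S = (\<Sum>i<m. conformal_increment \<Omega> \<gamma> (t i) (t (Suc i)))"
      and a: "t 0 = a" and u: "t m = u" and step: "\<forall>i<m. t i < t (Suc i)"
    define t' where "t' i = (if i \<le> m then t i else v)" for i
    have "?V v \<gamma> \<le> (\<Sum>i<Suc m. conformal_increment \<Omega> \<gamma> (t' i) (t' (Suc i)))"
      unfolding conformal_length_def
    proof (rule Inf_lower, rule CollectI, rule exI[of _ t'], rule exI[of _ "Suc m"], intro conjI allI impI refl)
      show "t' 0 = a" "t' (Suc m) = v" by (auto simp: t'_def a)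
      fix i assume "i < Suc m"
      then show "t' i < t' (Suc i)" using step assms u by (cases "i = m") (auto simp: t'_def)
    qed
    also have "\<dots> = (\<Sum>i<m. conformal_increment \<Omega> \<gamma> (t' i) (t' (Suc i))) + conformal_increment \<Omega> \<gamma> u v"
      by (simp add: t'_def u)
    also have "(\<Sum>i<m. conformal_increment \<Omega> \<gamma> (t' i) (t' (Suc i))) = S"
      unfolding S by (rule sum.cong) (auto simp: t'_def)
    finally have "?V v \<gamma> \<le> conformal_increment \<Omega> \<gamma> u v + S" by (subst add.commute)
    then show "?V v \<gamma> - conformal_increment \<Omega> \<gamma> u v \<le> S"
      unfolding ennreal_minus_le_iff using False by blast
  qed
  then have "?V v \<gamma> \<le> conformal_increment \<Omega> \<gamma> u v + ?V u \<gamma>"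
    unfolding ennreal_minus_le_iff by (rule conjunct1)
  then show ?thesis by (subst add.commute)
qed simp

text \<open>By continuity of \<open>\<Omega>\<close> along the curve, any weight \<open>\<omega>\<close> above \<open>\<Omega> (\<gamma> t)\<close> eventually exceeds the maximum
over \<open>{u..v}\<close>; the other factor is the flat bound for the time separation.\<close>

lemma increment_near:
  assumes sc: "strongly_causal A g T" and \<gamma>: "causal_curve A g T a b \<gamma>" and t: "t \<in> {a..b}"
    and \<Omega>: "continuous_on UNIV \<Omega>" "\<And>p. \<Omega> p > 0" and c: "c \<in> A" "\<gamma> t \<in> cdom c"
  obtains \<alpha> :: "'e \<Rightarrow> real" and P :: "'e \<Rightarrow> 'e"
  where "linear \<alpha>" "linear P" "\<And>v. chart_metric c (\<gamma> t) v v = (norm (P v))\<^sup>2 - (\<alpha> v)\<^sup>2"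
    "\<And>\<epsilon> \<omega>. \<epsilon> > 0 \<Longrightarrow> \<omega> > \<Omega> (\<gamma> t) \<Longrightarrow> \<forall>\<^sub>F (u, v) in straddle a b t. conformal_increment \<Omega> \<gamma> u v \<le>
      ennreal (\<omega> * sqrt ((1 + \<epsilon>) * (\<alpha> (coord c (\<gamma> v) - coord c (\<gamma> u)))\<^sup>2
        - (norm (P (coord c (\<gamma> v) - coord c (\<gamma> u))))\<^sup>2))"
proof -
  obtain \<alpha> :: "'e \<Rightarrow> real" and P :: "'e \<Rightarrow> 'e"
  where lin: "linear \<alpha>" "linear P" and form: "\<And>v. chart_metric c (\<gamma> t) v v = (norm (P v))\<^sup>2 - (\<alpha> v)\<^sup>2"
    and near: "\<And>\<epsilon>. \<epsilon> > 0 \<Longrightarrow> \<exists>V. open V \<and> \<gamma> t \<in> V \<and> (\<forall>x\<in>V. \<forall>y\<in>V. time_separation A g T x y \<le>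
      ennreal (sqrt ((1 + \<epsilon>) * (\<alpha> (coord c y - coord c x))\<^sup>2 - (norm (P (coord c y - coord c x)))\<^sup>2)))"
    by (rule time_separation_near[OF sc c]) (rule that)
  have cont: "(\<gamma> \<longlongrightarrow> \<gamma> t) (at t within {a..b})"
    using causal_curve_continuous[OF \<gamma>] t unfolding continuous_on_def by blast
  show thesis
  proof (rule that[OF lin form])
    fix \<epsilon> \<omega> :: real assume \<epsilon>: "\<epsilon> > 0" and \<omega>: "\<omega> > \<Omega> (\<gamma> t)"
    from near[OF \<epsilon>] obtain V where V: "open V" "\<gamma> t \<in> V" "\<And>x y. x \<in> V \<Longrightarrow> y \<in> V \<Longrightarrow> time_separation A g T x y \<le>
      ennreal (sqrt ((1 + \<epsilon>) * (\<alpha> (coord c y - coord c x))\<^sup>2 - (norm (P (coord c y - coord c x)))\<^sup>2))"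
      by blast
    have "\<forall>\<^sub>F s in at t within {a..b}. \<gamma> s \<in> V" by (rule topological_tendstoD[OF cont V(1,2)])
    then have inV: "\<forall>\<^sub>F (u, v) in straddle a b t. \<gamma> u \<in> V \<and> \<gamma> v \<in> V"
      by (rule straddle_endpoints) (rule V(2))
    have "((\<lambda>s. \<Omega> (\<gamma> s)) \<longlongrightarrow> \<Omega> (\<gamma> t)) (at t within {a..b})"
      using continuous_on_tendsto_compose[OF \<Omega>(1) cont] by simp
    then have "\<forall>\<^sub>F s in at t within {a..b}. \<Omega> (\<gamma> s) < \<omega>" using \<omega> by (rule order_tendstoD)
    then obtain d where d: "d > 0" "\<And>s. s \<in> {a..b} \<Longrightarrow> dist s t < d \<Longrightarrow> \<Omega> (\<gamma> s) < \<omega>"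
      unfolding eventually_at using \<omega> by metis
    have "\<forall>\<^sub>F (u, v) in straddle a b t. (SUP s\<in>{u..v}. \<Omega> (\<gamma> s)) \<le> \<omega>"
      unfolding eventually_straddle
    proof (intro exI[of _ d] conjI d(1) allI impI, clarify)
      fix u v assume uv: "a \<le> u" "u \<le> t" "t \<le> v" "v \<le> b" "dist u t < d" "dist v t < d"
      show "(SUP s\<in>{u..v}. \<Omega> (\<gamma> s)) \<le> \<omega>"
      proof (rule cSUP_least)
        fix s assume "s \<in> {u..v}"
        then have "s \<in> {a..b}" "dist s t < d" using uv by (auto simp: dist_real_def)
        then show "\<Omega> (\<gamma> s) \<le> \<omega>" using d(2) by (blast intro: less_imp_le)
      qed (use uv in auto)
    qed
    from eventually_conj[OF inV this]
    have ev: "\<forall>\<^sub>F (u, v) in straddle a b t. (\<gamma> u \<in> V \<and> \<gamma> v \<in> V) \<and> (SUP s\<in>{u..v}. \<Omega> (\<gamma> s)) \<le> \<omega>"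
      by (rule eventually_mono) auto
    show "\<forall>\<^sub>F (u, v) in straddle a b t. conformal_increment \<Omega> \<gamma> u v \<le>
      ennreal (\<omega> * sqrt ((1 + \<epsilon>) * (\<alpha> (coord c (\<gamma> v) - coord c (\<gamma> u)))\<^sup>2
        - (norm (P (coord c (\<gamma> v) - coord c (\<gamma> u))))\<^sup>2))"
    proof (rule straddle_mono[OF ev])
      fix u v assume *: "(\<gamma> u \<in> V \<and> \<gamma> v \<in> V) \<and> (SUP s\<in>{u..v}. \<Omega> (\<gamma> s)) \<le> \<omega>"
      have "conformal_increment \<Omega> \<gamma> u v \<le> ennreal \<omega> *
        ennreal (sqrt ((1 + \<epsilon>) * (\<alpha> (coord c (\<gamma> v) - coord c (\<gamma> u)))\<^sup>2
          - (norm (P (coord c (\<gamma> v) - coord c (\<gamma> u))))\<^sup>2))"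
        using * V(3) by (intro mult_mono ennreal_leI) auto
      then show "conformal_increment \<Omega> \<gamma> u v \<le>
        ennreal (\<omega> * sqrt ((1 + \<epsilon>) * (\<alpha> (coord c (\<gamma> v) - coord c (\<gamma> u)))\<^sup>2
          - (norm (P (coord c (\<gamma> v) - coord c (\<gamma> u))))\<^sup>2))"
        by (subst ennreal_mult') (use \<omega> \<Omega>(2)[of "\<gamma> t"] in auto)
    qed
  qed
qed

text \<open>The crude bound that remains where \<open>\<gamma>\<close> has no derivative: the flat bound with \<open>\<epsilon> = 1\<close> is at most
\<open>2 \<bar>\<alpha> w\<bar>\<close>, and the coordinate difference \<open>w\<close> is controlled by the pointwise Lipschitz
condition.\<close>

lemma increment_lipschitz:
  assumes sc: "strongly_causal A g T" and \<gamma>: "causal_curve A g T a b \<gamma>" and t: "t \<in> {a..b}"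
    and \<Omega>: "continuous_on UNIV \<Omega>" "\<And>p. \<Omega> p > 0"
  shows "\<exists>K. \<forall>\<^sub>F (u, v) in straddle a b t. conformal_increment \<Omega> \<gamma> u v \<le> ennreal (K * (v - u))"
proof -
  obtain c where c: "c \<in> A" "\<gamma> t \<in> cdom c" by (rule chart_at)
  let ?w = "\<lambda>u v. coord c (\<gamma> v) - coord c (\<gamma> u)"
  obtain \<alpha> :: "'e \<Rightarrow> real" and P :: "'e \<Rightarrow> 'e"
  where lin: "linear \<alpha>" "linear P"
    and near: "\<And>\<epsilon> \<omega>. \<epsilon> > 0 \<Longrightarrow> \<omega> > \<Omega> (\<gamma> t) \<Longrightarrow> \<forall>\<^sub>F (u, v) in straddle a b t. conformal_increment \<Omega> \<gamma> u v \<le>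
      ennreal (\<omega> * sqrt ((1 + \<epsilon>) * (\<alpha> (?w u v))\<^sup>2 - (norm (P (?w u v)))\<^sup>2))"
    by (rule increment_near[OF sc \<gamma> t \<Omega> c]) (rule that)
  obtain M where M: "M > 0" "\<And>x. norm (\<alpha> x) \<le> M * norm x" using linear_bounded_pos[OF lin(1)] by blast
  obtain K where "\<forall>\<^sub>F s in at t within {a..b}. norm ((coord c \<circ> \<gamma>) s - (coord c \<circ> \<gamma>) t) \<le> K * \<bar>s - t\<bar>"
    using causal_curve_pointwise_lipschitz[OF \<gamma> t c] by blast
  then have "\<forall>\<^sub>F (u, v) in straddle a b t. norm ((coord c \<circ> \<gamma>) u - (coord c \<circ> \<gamma>) t) \<le> K * \<bar>u - t\<bar> \<and>
      norm ((coord c \<circ> \<gamma>) v - (coord c \<circ> \<gamma>) t) \<le> K * \<bar>v - t\<bar>"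
    by (rule straddle_endpoints) simp
  from eventually_conj[OF this near[of 1 "\<Omega> (\<gamma> t) + 1"]]
  have ev: "\<forall>\<^sub>F (u, v) in straddle a b t. (norm ((coord c \<circ> \<gamma>) u - (coord c \<circ> \<gamma>) t) \<le> K * \<bar>u - t\<bar> \<and>
      norm ((coord c \<circ> \<gamma>) v - (coord c \<circ> \<gamma>) t) \<le> K * \<bar>v - t\<bar>) \<and> conformal_increment \<Omega> \<gamma> u v \<le>
      ennreal ((\<Omega> (\<gamma> t) + 1) * sqrt ((1 + 1) * (\<alpha> (?w u v))\<^sup>2 - (norm (P (?w u v)))\<^sup>2))"
    by (auto elim: eventually_mono)
  show ?thesis
  proof (intro exI, rule straddle_mono[OF ev], elim conjE)
    fix u v assume uv: "u \<le> t" "t \<le> v"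
      and u: "norm ((coord c \<circ> \<gamma>) u - (coord c \<circ> \<gamma>) t) \<le> K * \<bar>u - t\<bar>"
      and v: "norm ((coord c \<circ> \<gamma>) v - (coord c \<circ> \<gamma>) t) \<le> K * \<bar>v - t\<bar>"
      and inc: "conformal_increment \<Omega> \<gamma> u v \<le>
        ennreal ((\<Omega> (\<gamma> t) + 1) * sqrt ((1 + 1) * (\<alpha> (?w u v))\<^sup>2 - (norm (P (?w u v)))\<^sup>2))"
    have "norm (?w u v) \<le> norm ((coord c \<circ> \<gamma>) v - (coord c \<circ> \<gamma>) t) + norm ((coord c \<circ> \<gamma>) u - (coord c \<circ> \<gamma>) t)"
      using norm_triangle_ineq4[of "(coord c \<circ> \<gamma>) v - (coord c \<circ> \<gamma>) t" "(coord c \<circ> \<gamma>) u - (coord c \<circ> \<gamma>) t"]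
      by simp
    also have "\<dots> \<le> K * (v - u)" using u v uv by (simp add: algebra_simps)
    finally have w: "M * norm (?w u v) \<le> M * (K * (v - u))" using M(1) by simp
    have "sqrt ((1 + 1) * (\<alpha> (?w u v))\<^sup>2 - (norm (P (?w u v)))\<^sup>2) \<le> sqrt ((2 * \<bar>\<alpha> (?w u v)\<bar>)\<^sup>2)"
      by (intro real_sqrt_le_mono) (simp add: power_mult_distrib, smt (verit) zero_le_power2)
    also have "\<dots> = 2 * \<bar>\<alpha> (?w u v)\<bar>" by (simp only: real_sqrt_abs abs_mult abs_numeral abs_abs)
    also have "\<dots> \<le> 2 * (M * (K * (v - u)))" using M(2)[of "?w u v"] w by simp
    finally have "(\<Omega> (\<gamma> t) + 1) * sqrt ((1 + 1) * (\<alpha> (?w u v))\<^sup>2 - (norm (P (?w u v)))\<^sup>2)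
        \<le> (\<Omega> (\<gamma> t) + 1) * (2 * (M * (K * (v - u))))"
      using \<Omega>(2)[of "\<gamma> t"] by (intro mult_left_mono) auto
    also have "\<dots> = ((\<Omega> (\<gamma> t) + 1) * 2 * M * K) * (v - u)" by (simp only: mult_ac)
    finally show "conformal_increment \<Omega> \<gamma> u v \<le> ennreal (((\<Omega> (\<gamma> t) + 1) * 2 * M * K) * (v - u))"
      using inc by (meson ennreal_leI order_trans)
  qed
qed

text \<open>The coordinate difference of \<open>\<gamma> u\<close> and \<open>\<gamma> v\<close>, divided by \<open>v - u\<close>, tends to the velocity \<open>D\<close>. The bound of
\<open>increment_near\<close> is continuous, and homogeneous of degree one in this difference; in the limit
\<open>\<epsilon> = 0\<close>, \<open>\<omega> = \<Omega>\<close> it takes at \<open>D\<close> the value \<open>\<Omega> * speed\<close>.\<close>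

lemma increment_derivative:
  assumes sc: "strongly_causal A g T" and \<gamma>: "causal_curve A g T a b \<gamma>" and t: "t \<in> {a..b}"
    and reg: "regular_causal_at \<gamma> t"
    and \<Omega>: "continuous_on UNIV \<Omega>" "\<And>p. \<Omega> p > 0" and \<eta>: "\<eta> > 0"
  shows "\<forall>\<^sub>F (u, v) in straddle a b t. u < v \<longrightarrow>
    conformal_increment \<Omega> \<gamma> u v \<le> ennreal ((\<Omega> (\<gamma> t) * speed \<gamma> t + \<eta>) * (v - u))"
proof -
  obtain c where c: "c \<in> A" "\<gamma> t \<in> cdom c" by (rule chart_at)
  let ?w = "\<lambda>u v. coord c (\<gamma> v) - coord c (\<gamma> u)"
  obtain \<alpha> :: "'e \<Rightarrow> real" and P :: "'e \<Rightarrow> 'e"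
  where lin: "linear \<alpha>" "linear P" and form: "\<And>v. chart_metric c (\<gamma> t) v v = (norm (P v))\<^sup>2 - (\<alpha> v)\<^sup>2"
    and near: "\<And>\<epsilon> \<omega>. \<epsilon> > 0 \<Longrightarrow> \<omega> > \<Omega> (\<gamma> t) \<Longrightarrow> \<forall>\<^sub>F (u, v) in straddle a b t. conformal_increment \<Omega> \<gamma> u v \<le>
      ennreal (\<omega> * sqrt ((1 + \<epsilon>) * (\<alpha> (?w u v))\<^sup>2 - (norm (P (?w u v)))\<^sup>2))"
    by (rule increment_near[OF sc \<gamma> t \<Omega> c]) (rule that)
  define Q where "Q \<epsilon> x = sqrt ((1 + \<epsilon>) * (\<alpha> x)\<^sup>2 - (norm (P x))\<^sup>2)" for \<epsilon> x
  define D where "D = vector_derivative (coord c \<circ> \<gamma>) (at t)"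
  have D: "((coord c \<circ> \<gamma>) has_vector_derivative D) (at t within {a..b})"
    unfolding D_def by (rule has_vector_derivative_at_within[OF regular_causal_in_chart(1)[OF reg c]])
  have sp: "speed \<gamma> t = Q 0 D"
    using regular_causal_in_chart(4)[OF reg c] by (simp add: D_def Q_def form)
  \<comment> \<open>Joint continuity in the weight \<open>\<omega>\<close>, the width \<open>\<epsilon>\<close> of the cone and the direction; the
    point \<open>z\<close> is the limit configuration.\<close>
  define z where "z = (\<Omega> (\<gamma> t), 0::real, D)"
  have id: "((\<lambda>y. y) \<longlongrightarrow> z) (nhds z)" by (rule filterlim_ident)
  note y1 = tendsto_fst[OF id] and y2 = tendsto_fst[OF tendsto_snd[OF id]]
    and y3 = tendsto_snd[OF tendsto_snd[OF id]]
  note \<alpha>y = bounded_linear.tendsto[OF linear_linear[THEN iffD2, OF lin(1)] y3]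
    and Py = bounded_linear.tendsto[OF linear_linear[THEN iffD2, OF lin(2)] y3]
  have "((\<lambda>y. fst y * Q (fst (snd y)) (snd (snd y))) \<longlongrightarrow> fst z * Q (fst (snd z)) (snd (snd z))) (nhds z)"
    unfolding Q_def
    by (rule tendsto_mult[OF y1 tendsto_real_sqrt[OF tendsto_diff[OF
          tendsto_mult[OF tendsto_add[OF tendsto_const y2] tendsto_power[OF \<alpha>y]]
          tendsto_power[OF tendsto_norm[OF Py]]]]])
  then have "((\<lambda>y. fst y * Q (fst (snd y)) (snd (snd y))) \<longlongrightarrow> \<Omega> (\<gamma> t) * Q 0 D) (nhds (\<Omega> (\<gamma> t), 0, D))"
    by (simp add: z_def)
  then have "\<forall>\<^sub>F y in nhds (\<Omega> (\<gamma> t), 0, D). fst y * Q (fst (snd y)) (snd (snd y)) < \<Omega> (\<gamma> t) * Q 0 D + \<eta>"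
    by (rule order_tendstoD) (use \<eta> in simp)
  then obtain d where d: "d > 0" "\<And>y. dist y (\<Omega> (\<gamma> t), 0, D) < d \<Longrightarrow>
      fst y * Q (fst (snd y)) (snd (snd y)) < \<Omega> (\<gamma> t) * Q 0 D + \<eta>"
    unfolding eventually_nhds_metric by blast
  \<comment> \<open>Three deviations of size at most \<open>\<rho>\<close> add up to less than \<open>d\<close>.\<close>
  define \<rho> where "\<rho> = d / 4"
  have \<rho>: "\<rho> > 0" using d(1) by (simp add: \<rho>_def)
  have close: "(\<Omega> (\<gamma> t) + \<rho>) * Q \<rho> x \<le> \<Omega> (\<gamma> t) * speed \<gamma> t + \<eta>" if "norm (x - D) \<le> \<rho>" for x
  proof -
    have "dist (\<Omega> (\<gamma> t) + \<rho>, \<rho>, x) (\<Omega> (\<gamma> t), 0, D) \<le> \<rho> + (\<rho> + norm (x - D))"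
      using norm_Pair_le[of \<rho> "(\<rho>, x - D)"] norm_Pair_le[of \<rho> "x - D"] \<rho> by (simp add: dist_norm)
    also have "\<dots> < d" using that \<rho> by (simp add: \<rho>_def)
    finally show ?thesis using d(2)[of "(\<Omega> (\<gamma> t) + \<rho>, \<rho>, x)"] by (simp add: sp)
  qed
  obtain \<delta> where "\<delta> > 0" "\<And>y. y \<in> {a..b} \<Longrightarrow> norm (y - t) < \<delta> \<Longrightarrow>
      norm ((coord c \<circ> \<gamma>) y - (coord c \<circ> \<gamma>) t - (y - t) *\<^sub>R D) \<le> \<rho> * norm (y - t)"
    using D \<rho> unfolding has_vector_derivative_def has_derivative_within_alt by meson
  then have "\<forall>\<^sub>F s in at t within {a..b}. norm ((coord c \<circ> \<gamma>) s - (coord c \<circ> \<gamma>) t - (s - t) *\<^sub>R D) \<le> \<rho> * \<bar>s - t\<bar>"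
    unfolding eventually_at by (auto simp: dist_real_def)
  then have "\<forall>\<^sub>F (u, v) in straddle a b t.
      norm ((coord c \<circ> \<gamma>) u - (coord c \<circ> \<gamma>) t - (u - t) *\<^sub>R D) \<le> \<rho> * \<bar>u - t\<bar> \<and>
      norm ((coord c \<circ> \<gamma>) v - (coord c \<circ> \<gamma>) t - (v - t) *\<^sub>R D) \<le> \<rho> * \<bar>v - t\<bar>"
    by (rule straddle_endpoints) simp
  from eventually_conj[OF this near[of \<rho> "\<Omega> (\<gamma> t) + \<rho>"]]
  have ev: "\<forall>\<^sub>F (u, v) in straddle a b t.
      (norm ((coord c \<circ> \<gamma>) u - (coord c \<circ> \<gamma>) t - (u - t) *\<^sub>R D) \<le> \<rho> * \<bar>u - t\<bar> \<and>
      norm ((coord c \<circ> \<gamma>) v - (coord c \<circ> \<gamma>) t - (v - t) *\<^sub>R D) \<le> \<rho> * \<bar>v - t\<bar>) \<and>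
      conformal_increment \<Omega> \<gamma> u v \<le> ennreal ((\<Omega> (\<gamma> t) + \<rho>) * Q \<rho> (?w u v))"
    using \<rho> by (auto simp: Q_def elim: eventually_mono)
  show ?thesis
  proof (rule straddle_mono[OF ev], elim conjE, rule impI)
    fix u v assume uv: "u \<le> t" "t \<le> v" "u < v"
      and u: "norm ((coord c \<circ> \<gamma>) u - (coord c \<circ> \<gamma>) t - (u - t) *\<^sub>R D) \<le> \<rho> * \<bar>u - t\<bar>"
      and v: "norm ((coord c \<circ> \<gamma>) v - (coord c \<circ> \<gamma>) t - (v - t) *\<^sub>R D) \<le> \<rho> * \<bar>v - t\<bar>"
      and inc: "conformal_increment \<Omega> \<gamma> u v \<le> ennreal ((\<Omega> (\<gamma> t) + \<rho>) * Q \<rho> (?w u v))"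
    define x where "x = (1 / (v - u)) *\<^sub>R ?w u v"
    have w: "?w u v = (v - u) *\<^sub>R x" using uv by (simp add: x_def)
    have "(v - u) *\<^sub>R (x - D) = ((coord c \<circ> \<gamma>) v - (coord c \<circ> \<gamma>) t - (v - t) *\<^sub>R D)
        - ((coord c \<circ> \<gamma>) u - (coord c \<circ> \<gamma>) t - (u - t) *\<^sub>R D)"
      unfolding scaleR_diff_right w[symmetric] by (simp add: algebra_simps)
    then have "norm ((v - u) *\<^sub>R (x - D)) \<le> \<rho> * \<bar>v - t\<bar> + \<rho> * \<bar>u - t\<bar>"
      using order_trans[OF norm_triangle_ineq4 add_mono[OF v u]] by (simp only:)
    also have "\<dots> = (v - u) * \<rho>" using uv by (simp add: algebra_simps)
    finally have "norm (x - D) \<le> \<rho>" using uv by simp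
    note close = close[OF this]
    have "Q \<rho> (?w u v) = sqrt ((v - u)\<^sup>2 * ((1 + \<rho>) * (\<alpha> x)\<^sup>2 - (norm (P x))\<^sup>2))"
      unfolding Q_def w linear_cmul[OF lin(1)] linear_cmul[OF lin(2)]
      by (simp add: power_mult_distrib right_diff_distrib mult.left_commute)
    also have "\<dots> = (v - u) * Q \<rho> x" using uv by (simp add: Q_def real_sqrt_mult)
    finally have "(\<Omega> (\<gamma> t) + \<rho>) * Q \<rho> (?w u v) = ((\<Omega> (\<gamma> t) + \<rho>) * Q \<rho> x) * (v - u)" by simp
    also have "\<dots> \<le> (\<Omega> (\<gamma> t) * speed \<gamma> t + \<eta>) * (v - u)"
      using close uv by (intro mult_right_mono) auto
    finally show "conformal_increment \<Omega> \<gamma> u v \<le> ennreal ((\<Omega> (\<gamma> t) * speed \<gamma> t + \<eta>) * (v - u))"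
      using inc by (meson ennreal_leI order_trans)
  qed
qed

text \<open>The conformal length \<open>V t\<close> of the restriction to \<open>{a..t}\<close> grows over \<open>{u..v}\<close> by at most the
increment of \<open>{u..v}\<close>. Its upper derivative is therefore bounded by \<open>\<Omega> * speed\<close> almost everywhere
and finite everywhere, so it is at most the integral.\<close>

lemma conformal_length_le_weighted_length:
  assumes sc: "strongly_causal A g T" and \<gamma>: "causal_curve A g T a b \<gamma>"
    and \<Omega>: "continuous_on UNIV \<Omega>" "\<And>p. \<Omega> p > 0"
  shows "conformal_length (time_separation A g T) \<Omega> a b \<gamma>
    \<le> ennreal (integral {a..b} (\<lambda>t. \<Omega> (\<gamma> t) * speed \<gamma> t))"
proof -
  let ?V = "\<lambda>t. conformal_length (time_separation A g T) \<Omega> a t \<gamma>"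
  define I where "I = integral {a..b} (\<lambda>t. \<Omega> (\<gamma> t) * speed \<gamma> t)"
  define M where "M = \<bar>I\<bar> + 1"
  \<comment> \<open>Truncation at a level above the expected value \<open>I\<close> produces a real function without
    a separate proof that \<open>V\<close> is finite; the growth estimate survives it.\<close>
  define h where "h t = enn2real (min (?V t) (ennreal M))" for t
  have h: "ennreal (h t) = min (?V t) (ennreal M)" for t
    unfolding h_def by (rule ennreal_enn2real) (simp add: min_less_iff_disj)
  have h_nonneg: "0 \<le> h t" for t by (simp add: h_def)
  have inc: "h v - h u \<le> k" if "u < v" "conformal_increment \<Omega> \<gamma> u v \<le> ennreal k" "0 \<le> k" for u v k
  proof -
    have "?V v \<le> ?V u + ennreal k"
      using conformal_length_extend[OF that(1)] that(2) by (meson add_left_mono order_trans)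
    then have "min (?V v) (ennreal M) \<le> min (?V u) (ennreal M) + ennreal k"
      by (auto simp: min_def intro: order_trans)
    then have "ennreal (h v) \<le> ennreal (h u + k)" using that(3) h_nonneg by (simp add: h)
    then have "h v \<le> h u + k"
      by (subst (asm) ennreal_le_iff) (use h_nonneg[of u] that(3) in auto)
    then show ?thesis by simp
  qed
  obtain N where N: "negligible N" "\<And>t. t \<in> {a..b} - N \<Longrightarrow> a < t \<and> t < b \<and> regular_causal_at \<gamma> t"
    by (rule causal_curve_regular[OF \<gamma>]) (rule that)
  have "(\<lambda>t. \<Omega> (\<gamma> t) * speed \<gamma> t) integrable_on {a..b}"
  proof (rule weighted_length(1)[OF \<gamma>])
    show "continuous_on {a..b} (\<lambda>t. \<Omega> (\<gamma> t))"
      using continuous_on_compose2[OF \<Omega>(1) causal_curve_continuous[OF \<gamma>]] by simp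
  qed (simp add: \<Omega>(2) less_imp_le)
  then have int: "((\<lambda>t. \<Omega> (\<gamma> t) * speed \<gamma> t) has_integral I) {a..b}" unfolding I_def by blast
  have ab: "a \<le> b" using \<gamma> by (simp add: causal_curve_def)
  have "h b - h a \<le> I"
  proof (rule increment_le_integral[OF ab N(1) int])
    fix t assume t: "t \<in> {a..b}"
    obtain K where K: "\<forall>\<^sub>F (u, v) in straddle a b t. conformal_increment \<Omega> \<gamma> u v \<le> ennreal (K * (v - u))"
      using increment_lipschitz[OF sc \<gamma> t \<Omega>] by blast
    have "\<forall>\<^sub>F (u, v) in straddle a b t. h v - h u \<le> \<bar>K\<bar> * (v - u)"
    proof (rule straddle_mono[OF K])
      fix u v assume uv: "u \<le> t" "t \<le> v" and "conformal_increment \<Omega> \<gamma> u v \<le> ennreal (K * (v - u))"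
      moreover have "ennreal (K * (v - u)) \<le> ennreal (\<bar>K\<bar> * (v - u))"
        using uv by (intro ennreal_leI mult_right_mono) auto
      ultimately have "conformal_increment \<Omega> \<gamma> u v \<le> ennreal (\<bar>K\<bar> * (v - u))"
        by (meson order_trans)
      then show "h v - h u \<le> \<bar>K\<bar> * (v - u)"
        using inc[of u v "\<bar>K\<bar> * (v - u)"] uv by (cases "u = v") auto
    qed
    then show "\<exists>K. \<forall>\<^sub>F (u, v) in straddle a b t. h v - h u \<le> K * (v - u)" by blast
  next
    fix t \<eta> :: real assume t: "t \<in> {a..b} - N" and \<eta>: "0 < \<eta>"
    then have reg: "regular_causal_at \<gamma> t" using N(2) by blast
    have "\<forall>\<^sub>F (u, v) in straddle a b t. u < v \<longrightarrow>
        conformal_increment \<Omega> \<gamma> u v \<le> ennreal ((\<Omega> (\<gamma> t) * speed \<gamma> t + \<eta>) * (v - u))"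
      using increment_derivative[OF sc \<gamma> _ reg \<Omega> \<eta>] t by blast
    then show "\<forall>\<^sub>F (u, v) in straddle a b t. h v - h u \<le> (\<Omega> (\<gamma> t) * speed \<gamma> t + \<eta>) * (v - u)"
    proof (rule straddle_mono)
      fix u v assume uv: "u \<le> t" "t \<le> v" and "u < v \<longrightarrow>
        conformal_increment \<Omega> \<gamma> u v \<le> ennreal ((\<Omega> (\<gamma> t) * speed \<gamma> t + \<eta>) * (v - u))"
      moreover have "0 \<le> (\<Omega> (\<gamma> t) * speed \<gamma> t + \<eta>) * (v - u)"
        using regular_causal_speed_nonneg[OF reg] \<Omega>(2)[of "\<gamma> t"] \<eta> uv
        by (intro mult_nonneg_nonneg add_nonneg_nonneg) auto
      ultimately show "h v - h u \<le> (\<Omega> (\<gamma> t) * speed \<gamma> t + \<eta>) * (v - u)"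
        using inc[of u v] by (cases "u = v") auto
    qed
  qed
  moreover have "h a = 0" by (simp add: h_def conformal_length_refl)
  ultimately have "min (?V b) (ennreal M) \<le> ennreal I" using h[of b] ennreal_leI[of "h b" I] by simp
  moreover have "ennreal I < ennreal M" unfolding M_def by (rule ennreal_lessI) linarith+
  ultimately show ?thesis unfolding I_def[symmetric] by (auto simp: min_def split: if_splits)
qed

end

lemma conformal_metric_length:
  assumes "\<And>p. \<Omega> p > 0"
  shows "metric_length A (conformal_metric \<Omega> g) a b \<gamma> = (\<integral>\<^sup>+t. ennreal (\<Omega> (\<gamma> t) *
    sqrt (- g (\<gamma> t) (velocity A a b \<gamma> t) (velocity A a b \<gamma> t))) \<partial>lebesgue_on {a..b})"
proof -
  have "sqrt (- ((\<Omega> p)\<^sup>2 * x)) = \<Omega> p * sqrt (- x)" for p x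
    using assms[of p] real_sqrt_mult[of "(\<Omega> p)\<^sup>2" "- x"] by simp
  then show ?thesis by (simp add: metric_length_def conformal_metric_def)
qed

lemma conformal_causal_curve:
  assumes "\<And>p. \<Omega> p > 0"
  shows "causal_curve A (conformal_metric \<Omega> g) T a b \<gamma> \<longleftrightarrow> causal_curve A g T a b \<gamma>"
proof -
  have "future_causal (conformal_metric \<Omega> g) T p X \<longleftrightarrow> future_causal g T p X" for p X
    using assms[of p] by (simp add: future_causal_def conformal_metric_def mult_le_0_iff mult_less_0_iff)
  then show ?thesis by (simp add: causal_curve_def)
qed

theorem lemma4p1:
  fixes A :: "('a::{t2_space, second_countable_topology}, 'e::euclidean_space) chart set"
    and g :: "('a, 'e) metric"
    and T :: "'a \<Rightarrow> ('a, 'e) tvec"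
    and \<Omega> :: "'a \<Rightarrow> real"
  assumes "spacetime A g T"
    and "strongly_causal A g T"
    and "smooth_function A \<Omega>"
    and "\<And>p. \<Omega> p > 0"
  shows "(\<forall>a b \<gamma>. causal_curve A g T a b \<gamma> \<longrightarrow>
            conformal_length (time_separation A g T) \<Omega> a b \<gamma>
              = metric_length A (conformal_metric \<Omega> g) a b \<gamma> \<and>
            metric_length A (conformal_metric \<Omega> g) a b \<gamma>
              = (\<integral>\<^sup>+t. ennreal (\<Omega> (\<gamma> t) *
                   sqrt (- g (\<gamma> t) (velocity A a b \<gamma> t) (velocity A a b \<gamma> t))) \<partial>lebesgue_on {a..b}))
       \<and> conformal_time_separation A g T \<Omega> = time_separation A (conformal_metric \<Omega> g) T"
proof -
  interpret spacetime_atlas A g T by standard fact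
  have \<Omega>: "continuous_on UNIV \<Omega>" using assms(3) by (rule smooth_function_continuous)
  have main: "conformal_length (time_separation A g T) \<Omega> a b \<gamma>
      = metric_length A (conformal_metric \<Omega> g) a b \<gamma>" if \<gamma>: "causal_curve A g T a b \<gamma>" for a b \<gamma>
  proof -
    have "continuous_on {a..b} (\<lambda>t. \<Omega> (\<gamma> t))"
      using continuous_on_compose2[OF \<Omega> causal_curve_continuous[OF \<gamma>]] by simp
    then have "metric_length A (conformal_metric \<Omega> g) a b \<gamma>
        = ennreal (integral {a..b} (\<lambda>t. \<Omega> (\<gamma> t) * speed \<gamma> t))"
      using weighted_length(2)[OF \<gamma>, of "\<lambda>t. \<Omega> (\<gamma> t)"] assms(4)
      by (simp add: conformal_metric_length[of \<Omega>, OF assms(4)] less_imp_le)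
    moreover have "conformal_length (time_separation A g T) \<Omega> a b \<gamma>
        = ennreal (integral {a..b} (\<lambda>t. \<Omega> (\<gamma> t) * speed \<gamma> t))"
      by (intro antisym conformal_length_le_weighted_length weighted_length_le_conformal_length
          assms(2,4) \<gamma> \<Omega>)
    ultimately show ?thesis by simp
  qed
  have "conformal_time_separation A g T \<Omega> x y = time_separation A (conformal_metric \<Omega> g) T x y" for x y
  proof -
    have "{conformal_length (time_separation A g T) \<Omega> a b \<gamma> |a b \<gamma>.
          causal_curve A g T a b \<gamma> \<and> \<gamma> a = x \<and> \<gamma> b = y}
        = {metric_length A (conformal_metric \<Omega> g) a b \<gamma> |a b \<gamma>.
          causal_curve A g T a b \<gamma> \<and> \<gamma> a = x \<and> \<gamma> b = y}"
      by (intro Collect_cong iff_exI) (auto simp: main)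
    then show ?thesis
      unfolding conformal_time_separation_def time_separation_def[of _ "conformal_metric \<Omega> g"]
        conformal_causal_curve[of \<Omega>, OF assms(4)] by simp
  qed
  then show ?thesis
    using main conformal_metric_length[of \<Omega>, OF assms(4)] by blast
qed

end
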